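(* Every bounded dynamical system on $\mathbb{R}^n$ has a fixed point. That is: (i) if $f:\mathbb{R}^n\to\mathbb{R}^n$ is a continuous map and there is a compact set $W\subset\mathbb{R}^n$ such that the forward orbit under $f$ of every point $x\in\mathbb{R}^n$ intersects $W$, then there is a point $p\in\mathbb{R}^n$ with $f(p)=p$; and (ii) if $\varphi^t$ is a continuous flow on $\mathbb{R}^n$ and there is a compact set $W\subset\mathbb{R}^n$ such that the forward orbit under $\varphi^t$ of every point $x\in\mathbb{R}^n$ intersects $W$, then there is a point $p\in\mathbb{R}^n$ with $\varphi^t(p)=p$ for all $t\in\mathbb{R}$.
   Context: A dynamical system on a space $X$ means either a continuous map $f:X\to X$ (not necessarily invertible) or a continuous flow $\varphi^t$ on $X$ (a continuous action $\mathbb{R}\times X\to X$, $(t,x)\mapsto\varphi^t(x)$, of the additive group $\mathbb{R}$). The forward orbit of $x$ is $\{f^k(x):k\ge 0\}$ for a map and $\{\varphi^t(x):t\ge 0\}$ for a flow. A compact set $W\subset X$ is a window if the forward orbit of every $x\in X$ intersects $W$. A dynamical system is bounded if it has a window. *)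

theory Defs
  imports "HOL-Analysis.Analysis"
begin

text \<open>
  A dynamical system on the type \<open>'a\<close> is either a continuous map, not assumed to be
  invertible, or a continuous action of the additive group of the reals. In a flow
  \<open>\<phi>\<close>, the first argument is time. Continuity of a flow is joint continuity.
\<close>

definition continuous_flow :: "(real \<Rightarrow> 'a \<Rightarrow> 'a::topological_space) \<Rightarrow> bool" where
  "continuous_flow \<phi> \<longleftrightarrow>
     continuous_on UNIV (\<lambda>(t, x). \<phi> t x) \<and>
     (\<forall>x. \<phi> 0 x = x) \<and>
     (\<forall>s t x. \<phi> (s + t) x = \<phi> s (\<phi> t x))"

definition map_forward_orbit :: "('a \<Rightarrow> 'a) \<Rightarrow> 'a \<Rightarrow> 'a set" where
  "map_forward_orbit f x = {(f ^^ k) x | k::nat. k \<ge> 0}"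

definition flow_forward_orbit :: "(real \<Rightarrow> 'a \<Rightarrow> 'a) \<Rightarrow> 'a \<Rightarrow> 'a set" where
  "flow_forward_orbit \<phi> x = {\<phi> t x | t::real. t \<ge> 0}"

text \<open>
  The notion of a window depends on the system only through its forward orbits, so it
  is stated for the function \<open>orb\<close> that sends each point to its forward orbit.
\<close>

definition is_window :: "('a \<Rightarrow> 'a set) \<Rightarrow> 'a::topological_space set \<Rightarrow> bool" where
  "is_window orb W \<longleftrightarrow> compact W \<and> (\<forall>x. orb x \<inter> W \<noteq> {})"

definition bounded_map :: "('a \<Rightarrow> 'a::topological_space) \<Rightarrow> bool" where
  "bounded_map f \<longleftrightarrow> (\<exists>W. is_window (map_forward_orbit f) W)"

definition bounded_flow :: "(real \<Rightarrow> 'a \<Rightarrow> 'a::topological_space) \<Rightarrow> bool" where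
  "bounded_flow \<phi> \<longleftrightarrow> (\<exists>W. is_window (flow_forward_orbit \<phi>) W)"

end

theory Submission
  imports Defs "HOL-Library.Z2" "HOL-Library.Function_Algebras"
begin

text \<open>
  The window yields a cube \<open>B\<close> and an \<open>m\<close> with \<open>f ^^ k\<close> mapping \<open>B\<close> into its interior for all
  \<open>k \<ge> m\<close>. Subdivide \<open>\<real>\<^sup>n\<close> into a cubical grid and approximate \<open>f\<close> by a chain map \<open>\<phi>\<close>, modulo 2,
  sending each cell into the grid hull of its image; the cells reachable from \<open>B\<close> form a finite
  invariant complex \<open>N\<close>. If \<open>f\<close> has no fixed point, then on a fine grid no cell meets its own
  hull, so the total trace of \<open>\<phi>\<close> on \<open>N\<close> is \<open>0\<close>. Over the field with two elements, \<open>\<phi>\<close> and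
  \<open>\<phi> ^^ (2 ^ s)\<close> have the same trace. But for \<open>2 ^ s \<ge> m\<close> the latter maps all chains of \<open>N\<close> into
  \<open>B\<close>, where a contraction of the cube shows that its trace is \<open>1\<close>.

  For a flow, the time \<open>2 ^ -j\<close> maps have a common window, hence nonempty, compact, nested sets of
  fixed points; a point in all of them is fixed at all dyadic times.
\<close>

section \<open>Traces modulo 2\<close>

text \<open>Sums and products of bits stay in ring form, where the algebraic laws and the sum lemmas
  apply.\<close>

declare add_bit_eq_xor [simp del] mult_bit_eq_and [simp del]

text \<open>A cell of the cubical grid is encoded by integer coordinates: \<open>2 * j\<close> stands for the point
  \<open>j\<close>, and \<open>2 * j + 1\<close> for the interval from \<open>j\<close> to \<open>j + 1\<close>.\<close>

type_synonym 'n cell = "'n \<Rightarrow> int"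
text \<open>Chains of all dimensions are kept together and may have infinite support; finiteness
  enters through hypotheses on \<open>supp\<close>.\<close>

type_synonym 'c chain = "'c \<Rightarrow> bit"

definition supp :: "'c chain \<Rightarrow> 'c set" where
  "supp z = {x. z x \<noteq> 0}"

definition single :: "'c \<Rightarrow> 'c chain" where
  "single Q = (\<lambda>x. if x = Q then 1 else 0)"

lemma bit_add_self [simp]: "x + x = (0::bit)"
  by (cases x) simp_all

lemma bit_add_self_left [simp]: "x + (x + y) = (y::bit)"
  by (simp flip: add.assoc)

lemma bit_mult_self [simp]: "x * x = (x::bit)"
  by (cases x) simp_all

lemma chain_add_self [simp]: "z + z = (0 :: 'c chain)"
  by (simp add: fun_eq_iff)

lemma chain_add_self_left [simp]: "z + (z + w) = (w :: 'c chain)"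
  by (simp flip: add.assoc)

lemma bit_add_eq_0_iff: "x + y = 0 \<longleftrightarrow> x = (y::bit)"
  by (cases x; cases y) simp_all

lemma sum_fun_apply: "(\<Sum>i\<in>I. f i) x = (\<Sum>i\<in>I. f i x)"
  by (induction I rule: infinite_finite_induct) simp_all

lemma supp_single [simp]: "supp (single Q) = {Q}"
  by (auto simp: supp_def single_def)

lemma supp_zero [simp]: "supp 0 = {}"
  by (simp add: supp_def)

lemma supp_add: "supp (z + w) \<subseteq> supp z \<union> supp w"
  by (auto simp: supp_def)

lemma chain_eq_sum_single:
  assumes "finite S" "supp z \<subseteq> S"
  shows "z = (\<Sum>P\<in>S. if z P = 0 then 0 else single P)"
proof
  fix x
  have "(\<Sum>P\<in>S. if z P = 0 then 0 else single P) x = (\<Sum>P\<in>S. if P = x then z x else 0)"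
    unfolding sum_fun_apply by (rule sum.cong) (auto simp: single_def)
  also have "\<dots> = z x"
    using assms by (auto simp: supp_def)
  finally show "z x = (\<Sum>P\<in>S. if z P = 0 then 0 else single P) x" by simp
qed

text \<open>Over the field with two elements additivity is linearity, so
  \<open>A (single P) x\<close> is the matrix of \<open>A\<close> on chains with finite
  support.\<close>

lemma additive_apply:
  assumes "Modules.additive A" "finite S" "supp z \<subseteq> S"
  shows "A z x = (\<Sum>P\<in>S. z P * A (single P) x)"
proof -
  interpret Modules.additive A by fact
  have "A z x = (\<Sum>P\<in>S. A (if z P = 0 then 0 else single P)) x"
    using chain_eq_sum_single[OF assms(2,3)] sum by metis
  also have "\<dots> = (\<Sum>P\<in>S. z P * A (single P) x)"
    unfolding sum_fun_apply by (rule sum.cong) (auto simp: zero)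
  finally show ?thesis .
qed

lemma additive_eqI:
  fixes A B :: "'c chain \<Rightarrow> 'd chain"
  assumes A: "Modules.additive A" and B: "Modules.additive B" and "finite (supp z)"
    and eq: "\<And>P. P \<in> supp z \<Longrightarrow> A (single P) = B (single P)"
  shows "A z = B z"
proof
  fix x
  show "A z x = B z x"
    unfolding additive_apply[OF A assms(3) order_refl] additive_apply[OF B assms(3) order_refl]
    using eq by (intro sum.cong) auto
qed

lemma additive_supp:
  assumes "Modules.additive A" "finite (supp z)"
    and "\<And>P. P \<in> supp z \<Longrightarrow> supp (A (single P)) \<subseteq> S"
  shows "supp (A z) \<subseteq> S"
proof
  fix x assume "x \<in> supp (A z)"
  then have "(\<Sum>P\<in>supp z. z P * A (single P) x) \<noteq> 0"
    using additive_apply[OF assms(1,2) order_refl] by (simp add: supp_def)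
  then obtain P where "P \<in> supp z" "z P * A (single P) x \<noteq> 0"
    by (rule sum.not_neutral_contains_not_neutral)
  then show "x \<in> S"
    using assms(3)[of P] by (auto simp: supp_def)
qed

lemma additive_comp:
  "Modules.additive A \<Longrightarrow> Modules.additive B \<Longrightarrow> Modules.additive (A \<circ> B)"
  by (simp add: Modules.additive_def)

lemma additive_plus:
  assumes "Modules.additive A" "Modules.additive B"
  shows "Modules.additive (\<lambda>z. A z + B z)"
  using assms by (simp add: Modules.additive_def algebra_simps)

lemma additive_funpow:
  fixes A :: "'c chain \<Rightarrow> 'c chain"
  shows "Modules.additive A \<Longrightarrow> Modules.additive (A ^^ k)"
proof (induction k)
  case (Suc k)
  then show ?case
    using additive_comp[of A "A ^^ k"] by (simp add: comp_def)
qed (simp add: Modules.additive_def)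

text \<open>Modulo 2, the off-diagonal terms of a symmetric double sum cancel in pairs.\<close>

lemma sum_symmetric_bit:
  fixes F :: "'a \<Rightarrow> 'a \<Rightarrow> bit"
  assumes "finite I" "\<And>i j. i \<in> I \<Longrightarrow> j \<in> I \<Longrightarrow> F i j = F j i"
  shows "(\<Sum>i\<in>I. \<Sum>j\<in>I. F i j) = (\<Sum>i\<in>I. F i i)"
  using assms
proof (induction I rule: finite_induct)
  case (insert a I)
  have "(\<Sum>j\<in>I. F j a) = (\<Sum>j\<in>I. F a j)"
    using insert.prems by (intro sum.cong refl) blast
  moreover have "(\<Sum>i\<in>I. \<Sum>j\<in>I. F i j) = (\<Sum>i\<in>I. F i i)"
    using insert.prems by (intro insert.IH) blast
  ultimately show ?case
    using insert.hyps by (simp add: sum.distrib add_ac)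
qed simp

text \<open>All dimensions are summed together: since -1 = 1 modulo 2, the total trace already is
  the alternating trace of Lefschetz.\<close>

definition trace_on :: "'c set \<Rightarrow> ('c chain \<Rightarrow> 'c chain) \<Rightarrow> bit" where
  "trace_on S A = (\<Sum>Q\<in>S. A (single Q) Q)"

definition preserves :: "'c set \<Rightarrow> ('c chain \<Rightarrow> 'c chain) \<Rightarrow> bool" where
  "preserves S A \<longleftrightarrow> (\<forall>z. supp z \<subseteq> S \<longrightarrow> supp (A z) \<subseteq> S)"

lemma preserves_comp: "preserves S A \<Longrightarrow> preserves S B \<Longrightarrow> preserves S (A \<circ> B)"
  by (simp add: preserves_def)

lemma preserves_funpow: "preserves S A \<Longrightarrow> preserves S (A ^^ k)"
proof (induction k)
  case (Suc k)
  then show ?case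
    using preserves_comp[of S A "A ^^ k"] by (simp add: comp_def)
qed (simp add: preserves_def)

text \<open>This is matrix multiplication; since \<open>B\<close> preserves \<open>S\<close>, the
  intermediate cell \<open>P\<close> may be restricted to \<open>S\<close>.\<close>

lemma trace_on_comp:
  assumes "Modules.additive A" "preserves S B" "finite S"
  shows "trace_on S (A \<circ> B) = (\<Sum>Q\<in>S. \<Sum>P\<in>S. B (single Q) P * A (single P) Q)"
  unfolding trace_on_def
proof (rule sum.cong)
  fix Q assume "Q \<in> S"
  then have "supp (B (single Q)) \<subseteq> S"
    using assms(2) by (simp add: preserves_def)
  then show "(A \<circ> B) (single Q) Q = (\<Sum>P\<in>S. B (single Q) P * A (single P) Q)"
    using additive_apply[OF assms(1,3)] by simp
qed simp

lemma trace_on_commute: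
  assumes "Modules.additive A" "Modules.additive B" "preserves S A" "preserves S B" "finite S"
  shows "trace_on S (A \<circ> B) = trace_on S (B \<circ> A)"
  unfolding trace_on_comp[OF assms(1,4,5)] trace_on_comp[OF assms(2,3,5)]
  by (subst sum.swap) (simp add: mult.commute)

text \<open>The products of the entries at (P, Q) and (Q, P) are symmetric, so the off-diagonal ones
  cancel; a diagonal product is the square of a bit, hence the bit itself.\<close>

lemma trace_on_square:
  assumes "Modules.additive A" "preserves S A" "finite S"
  shows "trace_on S (A \<circ> A) = trace_on S A"
  unfolding trace_on_comp[OF assms]
  by (subst sum_symmetric_bit[OF assms(3)]) (simp_all add: mult.commute trace_on_def)

lemma trace_on_power:
  assumes "Modules.additive A" "preserves S A" "finite S"
  shows "trace_on S (A ^^ (2 ^ s)) = trace_on S A"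
proof (induction s)
  case (Suc s)
  have "A ^^ (2 ^ Suc s) = A ^^ (2 ^ s) \<circ> A ^^ (2 ^ s)"
    by (simp only: power_Suc mult_2 funpow_add)
  then show ?case
    using Suc trace_on_square[OF additive_funpow[OF assms(1)] preserves_funpow[OF assms(2)] assms(3)]
    by (simp only:)
qed simp

section \<open>Cubical chains modulo 2\<close>

text \<open>The cubical boundary in direction \<open>k\<close>, written by coefficients: a cell that
  is a point in direction \<open>k\<close> collects the coefficients of the two cells having it as
  an end in that direction.\<close>

definition bdk :: "'n \<Rightarrow> 'n cell chain \<Rightarrow> 'n cell chain" where
  "bdk k z x = (if even (x k) then z (x(k := x k + 1)) + z (x(k := x k - 1)) else 0)"

definition bd :: "'n::finite cell chain \<Rightarrow> 'n cell chain" where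
  "bd z = (\<Sum>k\<in>UNIV. bdk k z)"

lemma additive_bdk: "Modules.additive (bdk k)"
  by (simp add: Modules.additive_def bdk_def fun_eq_iff add_ac)

lemma bdk_add: "bdk k (z + w) = bdk k z + bdk k w"
  by (rule Modules.additive.add[OF additive_bdk])

lemma additive_bd: "Modules.additive bd"
  by (simp add: Modules.additive_def bd_def bdk_add sum.distrib)

lemmas bd_add = Modules.additive.add[OF additive_bd]

lemma bd_zero [simp]: "bd 0 = 0"
  by (rule Modules.additive.zero[OF additive_bd])

lemma bdk_commute: "bdk k (bdk l z) = bdk l (bdk k z)"
  by (cases "k = l") (auto simp: bdk_def fun_eq_iff fun_upd_twist add_ac)

lemma bdk_bdk: "bdk k (bdk k z) = 0"
  by (auto simp: bdk_def fun_eq_iff)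

text \<open>Boundaries in different directions commute, so mixed terms cancel in pairs; the diagonal
  terms vanish by parity of the coordinate.\<close>

lemma bd_bd [simp]: "bd (bd z) = 0"
proof
  fix x
  have "bd (bd z) x = (\<Sum>k\<in>UNIV. \<Sum>l\<in>UNIV. bdk k (bdk l z) x)"
    by (simp add: bd_def sum_fun_apply Modules.additive.sum[OF additive_bdk])
  also have "\<dots> = (\<Sum>k\<in>UNIV. bdk k (bdk k z) x)"
    by (rule sum_symmetric_bit) (auto simp: bdk_commute)
  finally show "bd (bd z) x = 0 x" by (simp add: bdk_bdk)
qed

lemma supp_bdE:
  assumes "P \<in> supp (bd z)"
  obtains Q k where "Q \<in> supp z" "even (P k)" "Q = P(k := P k + 1) \<or> Q = P(k := P k - 1)"
proof -
  have "(\<Sum>k\<in>UNIV. bdk k z P) \<noteq> 0"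
    using assms by (simp add: supp_def bd_def sum_fun_apply)
  then obtain k where "bdk k z P \<noteq> 0"
    by (rule sum.not_neutral_contains_not_neutral)
  then have "even (P k)" "z (P(k := P k + 1)) \<noteq> 0 \<or> z (P(k := P k - 1)) \<noteq> 0"
    by (auto simp: bdk_def split: if_splits)
  with that show thesis
    by (auto simp: supp_def)
qed

section \<open>Face-closed sets and boxes of cells\<close>

definition face_closed :: "'n cell set \<Rightarrow> bool" where
  "face_closed S \<longleftrightarrow> (\<forall>P k. even (P k) \<and> (P(k := P k + 1) \<in> S \<or> P(k := P k - 1) \<in> S) \<longrightarrow> P \<in> S)"

lemma face_closedD:
  "face_closed S \<Longrightarrow> Q \<in> S \<Longrightarrow> even (P k) \<Longrightarrow> Q = P(k := P k + 1) \<or> Q = P(k := P k - 1) \<Longrightarrow> P \<in> S"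
  unfolding face_closed_def by blast

lemma preserves_bd: "face_closed S \<Longrightarrow> preserves S bd"
  unfolding preserves_def face_closed_def by (blast elim: supp_bdE)

definition vertex :: "'n cell \<Rightarrow> bool" where
  "vertex x \<longleftrightarrow> (\<forall>k. even (x k))"

lemma face_closed_UN: "(\<And>i. i \<in> I \<Longrightarrow> face_closed (F i)) \<Longrightarrow> face_closed (\<Union>i\<in>I. F i)"
  unfolding face_closed_def by blast

text \<open>Even corners matter: an even coordinate that lies within 1 of the range between two even
  bounds is already in that range.\<close>

lemma face_closed_box:
  assumes "vertex a" "vertex b"
  shows "face_closed {a..b}"
  unfolding face_closed_def
proof (intro allI impI)
  fix P :: "'a cell" and k
  assume P: "even (P k) \<and> (P(k := P k + 1) \<in> {a..b} \<or> P(k := P k - 1) \<in> {a..b})"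
  have ab: "even (a k)" "even (b k)"
    using assms by (auto simp: vertex_def)
  have "a j \<le> P j \<and> P j \<le> b j" for j
  proof (cases "j = k")
    case True
    have "even (P k)" "a k \<le> P k + 1 \<and> P k + 1 \<le> b k \<or> a k \<le> P k - 1 \<and> P k - 1 \<le> b k"
      using P by (auto simp: le_fun_def split: if_splits)
    then show ?thesis
      using ab unfolding True by presburger
  next
    case False
    then show ?thesis
      using P by (auto simp: le_fun_def split: if_splits)
  qed
  then show "P \<in> {a..b}"
    by (simp add: le_fun_def)
qed

lemma finite_box: "finite {a..b :: 'n::finite cell}"
proof -
  have "{a..b} = PiE UNIV (\<lambda>k. {a k..b k})"
    by (auto simp: le_fun_def PiE_def Pi_def)
  then show ?thesis
    by (simp add: finite_PiE)
qed

text \<open>The augmentation, a count of vertices modulo 2; the set \<open>S\<close> is there to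
  make the sum finite, as supports need not be.\<close>

definition eps :: "'n cell set \<Rightarrow> 'n cell chain \<Rightarrow> bit" where
  "eps S z = (\<Sum>x\<in>{x\<in>S. vertex x}. z x)"

lemma eps_add: "eps S (z + w) = eps S z + eps S w"
  by (simp add: eps_def sum.distrib)

lemma eps_zero [simp]: "eps S 0 = 0"
  by (simp add: eps_def)

lemma eps_single: "finite S \<Longrightarrow> Q \<in> S \<Longrightarrow> eps S (single Q) = (if vertex Q then 1 else 0)"
  by (simp add: eps_def single_def)

lemma eps_eq_0: "(\<And>x. vertex x \<Longrightarrow> z x = 0) \<Longrightarrow> eps S z = 0"
  by (simp add: eps_def)

lemma eps_superset:
  assumes "finite S" "T \<subseteq> S" "supp z \<subseteq> T"
  shows "eps S z = eps T z"
  unfolding eps_def using assms by (intro sum.mono_neutral_right) (auto simp: supp_def)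

text \<open>Every edge has two ends: in each direction, the sums of coefficients over vertices
  shifted up and over vertices shifted down both equal the sum over the edges in that
  direction.\<close>

lemma eps_bd:
  assumes S: "finite S" "face_closed S" "supp z \<subseteq> S"
  shows "eps S (bd z) = 0"
proof -
  let ?V = "{x\<in>S. vertex x}"
  let ?E = "\<lambda>k. {y\<in>S. odd (y k) \<and> (\<forall>j. j \<noteq> k \<longrightarrow> even (y j))}"
  have shift: "(\<Sum>x\<in>?V. z (x(k := x k + c))) = (\<Sum>y\<in>?E k. z y)" if c: "c = 1 \<or> c = -1" for k c
  \<comment> \<open>A shifted vertex may leave \<open>S\<close>, so the bijection is between nonzero
    terms only, where the support of \<open>z\<close> keeps the edge in \<open>S\<close>.\<close>
  proof (rule sum.reindex_bij_witness_not_neutral[where S' = "{x\<in>?V. z (x(k := x k + c)) = 0}"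
        and T' = "{y\<in>?E k. z y = 0}" and i = "\<lambda>y. y(k := y k - c)" and j = "\<lambda>x. x(k := x k + c)"])
    fix y assume y: "y \<in> ?E k - {y\<in>?E k. z y = 0}"
    define P where "P = y(k := y k - c)"
    have Pk: "even (P k)" and yP: "y = P(k := P k + c)"
      using y c by (auto simp: P_def)
    have yS: "y \<in> S"
      using y by simp
    have "y = P(k := P k + 1) \<or> y = P(k := P k - 1)"
      using c yP by (metis diff_conv_add_uminus)
    then have "P \<in> S"
      by (rule face_closedD[where P = P and k = k, OF S(2) yS Pk])
    moreover have "vertex P"
      using y c by (auto simp: P_def vertex_def)
    ultimately show "y(k := y k - c) \<in> ?V - {x\<in>?V. z (x(k := x k + c)) = 0}"
      using y unfolding P_def by auto
  next
    fix x assume "x \<in> ?V - {x\<in>?V. z (x(k := x k + c)) = 0}"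
    then show "x(k := x k + c) \<in> ?E k - {y\<in>?E k. z y = 0}"
      using S c by (auto simp: vertex_def supp_def)
  qed (use S in auto)
  have "eps S (bd z) = (\<Sum>k\<in>UNIV. \<Sum>x\<in>?V. bdk k z x)"
    unfolding eps_def bd_def sum_fun_apply by (rule sum.swap)
  also have "\<dots> = (\<Sum>k\<in>UNIV. (\<Sum>x\<in>?V. z (x(k := x k + 1))) + (\<Sum>x\<in>?V. z (x(k := x k + -1))))"
    by (simp add: bdk_def vertex_def sum.distrib)
  also have "\<dots> = 0"
    by (simp only: shift simp_thms bit_add_self) simp
  finally show ?thesis .
qed

text \<open>Along coordinate \<open>k\<close>, \<open>hk\<close> joins a cell to the face at \<open>\<alpha>\<close> by the intervals in between, and \<open>pk\<close>
  projects to that face; the sums express this on the coefficients of a chain.\<close>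

definition hk :: "'n \<Rightarrow> int \<Rightarrow> int \<Rightarrow> 'n cell chain \<Rightarrow> 'n cell chain" where
  "hk k \<alpha> \<beta> z x =
     (if odd (x k) \<and> \<alpha> < x k then \<Sum>j | even j \<and> x k < j \<and> j \<le> \<beta>. z (x(k := j)) else 0)"

definition pk :: "'n \<Rightarrow> int \<Rightarrow> int \<Rightarrow> 'n cell chain \<Rightarrow> 'n cell chain" where
  "pk k \<alpha> \<beta> z x =
     (if x k = \<alpha> then \<Sum>j | even j \<and> \<alpha> \<le> j \<and> j \<le> \<beta>. z (x(k := j)) else 0)"

lemma additive_hk: "Modules.additive (hk k \<alpha> \<beta>)"
  by (simp add: Modules.additive_def hk_def fun_eq_iff sum.distrib)

lemma additive_pk: "Modules.additive (pk k \<alpha> \<beta>)"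
  by (simp add: Modules.additive_def pk_def fun_eq_iff sum.distrib)

lemma bdk_hk_commute:
  assumes "k \<noteq> l"
  shows "bdk l (hk k \<alpha> \<beta> (z :: 'n cell chain)) = hk k \<alpha> \<beta> (bdk l z)"
proof
  fix x :: "'n cell"
  have "x(l := c, k := j) = x(k := j, l := c)" for c j
    using assms by (simp add: fun_upd_twist)
  then show "bdk l (hk k \<alpha> \<beta> z) x = hk k \<alpha> \<beta> (bdk l z) x"
    using assms by (simp add: bdk_def hk_def sum.distrib)
qed

lemma finite_even_interval [simp]:
  "finite {j::int. even j \<and> t < j \<and> j \<le> \<beta>}" "finite {j::int. even j \<and> t \<le> j \<and> j \<le> \<beta>}"
  by (rule finite_subset[of _ "{t..\<beta>}"]; auto)+

lemma sum_even_step: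
  fixes g :: "int \<Rightarrow> 'a::comm_monoid_add"
  assumes "even t" "t \<le> \<beta>"
  shows "(\<Sum>j | even j \<and> t - 1 < j \<and> j \<le> \<beta>. g j) = g t + (\<Sum>j | even j \<and> t + 1 < j \<and> j \<le> \<beta>. g j)"
proof -
  have "{j. even j \<and> t - 1 < j \<and> j \<le> \<beta>} = insert t {j. even j \<and> t + 1 < j \<and> j \<le> \<beta>}"
    using assms by (auto; presburger)
  then show ?thesis
    by simp
qed

text \<open>Odd arguments strictly above \<open>t\<close> either occur twice or exceed
  \<open>\<beta>\<close>, so only the lowest term survives.\<close>

lemma sum_even_telescope:
  fixes g :: "int \<Rightarrow> bit"
  assumes "odd t" "even \<beta>" and g: "\<And>j. \<beta> < j \<Longrightarrow> g j = 0"
  shows "(\<Sum>j | even j \<and> t < j \<and> j \<le> \<beta>. g (j + 1) + g (j - 1)) = g t"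
  using \<open>odd t\<close>
proof (induction "nat (\<beta> - t)" arbitrary: t rule: less_induct)
  case less
  show ?case
  proof (cases "t < \<beta>")
    case True
    have "(\<Sum>j | even j \<and> t + 2 < j \<and> j \<le> \<beta>. g (j + 1) + g (j - 1)) = g (t + 2)"
      using less True by (intro less.hyps) auto
    moreover have "(\<Sum>j | even j \<and> t < j \<and> j \<le> \<beta>. g (j + 1) + g (j - 1)) =
        (g (t + 2) + g t) + (\<Sum>j | even j \<and> t + 2 < j \<and> j \<le> \<beta>. g (j + 1) + g (j - 1))"
      using sum_even_step[of "t + 1" \<beta> "\<lambda>j. g (j + 1) + g (j - 1)"] less.prems True
      by (simp add: add.assoc)
    ultimately show ?thesis
      by (simp add: add_ac)
  next
    case False
    then have "\<beta> < t"
      using less.prems assms(2) by (metis linorder_neqE)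
    with g[OF \<open>\<beta> < t\<close>] show ?thesis
      by (auto intro: sum.neutral)
  qed
qed

text \<open>Parity of \<open>x k\<close> leaves one summand on the left: at an even coordinate
  \<open>hk\<close> vanishes and two neighbouring tail sums are compared; at an odd one the outer
  \<open>bdk\<close> vanishes and the sum telescopes.\<close>

lemma homotopy_one_coordinate:
  fixes z :: "'n cell chain"
  assumes ev: "even \<alpha>" "even \<beta>" and z: "\<And>x. z x \<noteq> 0 \<Longrightarrow> \<alpha> \<le> x k \<and> x k \<le> \<beta>"
  shows "bdk k (hk k \<alpha> \<beta> z) + hk k \<alpha> \<beta> (bdk k z) = z + pk k \<alpha> \<beta> z"
proof
  fix x :: "'n cell"
  define t where "t = x k"
  define g where "g j = z (x(k := j))" for j
  let ?S = "\<lambda>t. \<Sum>j | even j \<and> t < j \<and> j \<le> \<beta>. g j"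
  have g0: "g j = 0" if "j < \<alpha> \<or> \<beta> < j" for j
    using z[of "x(k := j)"] that by (metis fun_upd_same g_def not_less)
  have zx: "z x = g t"
    by (simp add: g_def t_def)
  have p: "pk k \<alpha> \<beta> z x = (if t = \<alpha> then ?S (t - 1) else 0)"
    by (auto simp: pk_def t_def g_def intro!: sum.cong)
  have "bdk k (hk k \<alpha> \<beta> z) x + hk k \<alpha> \<beta> (bdk k z) x = g t + (if t = \<alpha> then ?S (t - 1) else 0)"
  proof (cases "even t")
    case True
    have "bdk k (hk k \<alpha> \<beta> z) x + hk k \<alpha> \<beta> (bdk k z) x =
        (if \<alpha> < t + 1 then ?S (t + 1) else 0) + (if \<alpha> < t - 1 then ?S (t - 1) else 0)"
      using True by (simp add: bdk_def hk_def t_def g_def)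
    moreover have "?S (t - 1) = g t + ?S (t + 1)"
    proof (cases "t \<le> \<beta>")
      case True
      with \<open>even t\<close> show ?thesis by (rule sum_even_step)
    next
      case False
      then have "{j. even j \<and> t - 1 < j \<and> j \<le> \<beta>} = {}" "{j. even j \<and> t + 1 < j \<and> j \<le> \<beta>} = {}"
        by auto
      then show ?thesis using False g0 by simp
    qed
    \<comment> \<open>Parity excludes \<open>t = \<alpha> + 1\<close>. Above \<open>\<alpha>\<close>
      both tails are present and differ by \<open>g t\<close>; at \<open>\<alpha>\<close> the
      missing tail is the projection term; below, everything is 0.\<close>
    moreover have "\<alpha> < t + 1 \<and> \<alpha> < t - 1 \<and> t \<noteq> \<alpha> \<or> t = \<alpha> \<or> t < \<alpha>"
      using True ev(1) by presburger
    ultimately show ?thesis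
      using g0[of t] by (auto simp: add_ac)
  next
    case False
    have "bdk k (hk k \<alpha> \<beta> z) x + hk k \<alpha> \<beta> (bdk k z) x =
        (if \<alpha> < t then \<Sum>j | even j \<and> t < j \<and> j \<le> \<beta>. g (j + 1) + g (j - 1) else 0)"
      using False by (simp add: bdk_def hk_def t_def g_def)
    also have "\<dots> = (if \<alpha> < t then g t else 0)"
      using sum_even_telescope[of t \<beta> g] False ev(2) g0 by simp
    also have "\<dots> = g t + (if t = \<alpha> then ?S (t - 1) else 0)"
      using False ev(1) g0[of t] by auto
    finally show ?thesis .
  qed
  then show "(bdk k (hk k \<alpha> \<beta> z) + hk k \<alpha> \<beta> (bdk k z)) x = (z + pk k \<alpha> \<beta> z) x"
    using zx p by simp
qed

text \<open>The homotopy acts in direction \<open>k\<close> alone, so boundary terms in the other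
  directions commute with it and cancel.\<close>

lemma bd_hk:
  fixes z :: "'n::finite cell chain"
  assumes "even \<alpha>" "even \<beta>" and "\<And>x. z x \<noteq> 0 \<Longrightarrow> \<alpha> \<le> x k \<and> x k \<le> \<beta>"
  shows "bd (hk k \<alpha> \<beta> z) + hk k \<alpha> \<beta> (bd z) = z + pk k \<alpha> \<beta> z"
proof -
  have "bd (hk k \<alpha> \<beta> z) = bdk k (hk k \<alpha> \<beta> z) + (\<Sum>l\<in>UNIV - {k}. hk k \<alpha> \<beta> (bdk l z))"
    by (simp add: bd_def sum.remove[of UNIV k] bdk_hk_commute)
  moreover have "hk k \<alpha> \<beta> (bd z) = hk k \<alpha> \<beta> (bdk k z) + (\<Sum>l\<in>UNIV - {k}. hk k \<alpha> \<beta> (bdk l z))"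
    by (simp add: bd_def sum.remove[of UNIV k] Modules.additive.add[OF additive_hk]
        Modules.additive.sum[OF additive_hk])
  ultimately have "bd (hk k \<alpha> \<beta> z) + hk k \<alpha> \<beta> (bd z) = bdk k (hk k \<alpha> \<beta> z) + hk k \<alpha> \<beta> (bdk k z)"
    by (simp add: add_ac)
  also have "\<dots> = z + pk k \<alpha> \<beta> z"
    using assms by (rule homotopy_one_coordinate)
  finally show ?thesis .
qed

lemma supp_hkE:
  assumes "x \<in> supp (hk k \<alpha> \<beta> z)"
  obtains j where "x(k := j) \<in> supp z" "odd (x k)" "\<alpha> < x k" "x k < j" "j \<le> \<beta>"
proof -
  have x: "odd (x k)" "\<alpha> < x k" and "(\<Sum>j | even j \<and> x k < j \<and> j \<le> \<beta>. z (x(k := j))) \<noteq> 0"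
    using assms by (auto simp: supp_def hk_def split: if_splits)
  from this(3) obtain j where "even j \<and> x k < j \<and> j \<le> \<beta>" "z (x(k := j)) \<noteq> 0"
    by (rule sum.not_neutral_contains_not_neutral) auto
  with x show thesis
    by (intro that[of j]) (auto simp: supp_def)
qed

lemma supp_pkE:
  assumes "x \<in> supp (pk k \<alpha> \<beta> z)"
  obtains j where "x(k := j) \<in> supp z" "x k = \<alpha>" "\<alpha> \<le> j" "j \<le> \<beta>"
proof -
  have x: "x k = \<alpha>" and "(\<Sum>j | even j \<and> \<alpha> \<le> j \<and> j \<le> \<beta>. z (x(k := j))) \<noteq> 0"
    using assms by (auto simp: supp_def pk_def split: if_splits)
  from this(2) obtain j where "even j \<and> \<alpha> \<le> j \<and> j \<le> \<beta>" "z (x(k := j)) \<noteq> 0"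
    by (rule sum.not_neutral_contains_not_neutral) auto
  with x show thesis
    by (intro that[of j]) (auto simp: supp_def)
qed

section \<open>Contraction of a box of cells\<close>

lemma upd_box_trans:
  fixes x :: "'n cell"
  assumes "x(k := j) \<in> {a..b}" "a k \<le> x k" "x k \<le> b k"
  shows "x \<in> {a..b}"
proof -
  have "a i \<le> x i \<and> x i \<le> b i" for i
    using assms by (cases "i = k") (auto simp: le_fun_def split: if_splits)
  then show ?thesis
    by (simp add: le_fun_def)
qed

text \<open>The coordinates in \<open>S\<close> are collapsed one after another and the homotopies
  are concatenated. Vanishing of \<open>h z\<close> on vertices records that a homotopy creates no
  cells of dimension 0.\<close>

lemma box_collapse:
  fixes a b :: "'n::finite cell"
  assumes v: "vertex a" "vertex b" and "finite S"
  shows "\<exists>h T. Modules.additive h \<and> Modules.additive T \<and> preserves {a..b} h \<and> preserves {a..b} T \<and>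
    (\<forall>z. supp z \<subseteq> {a..b} \<longrightarrow> bd (h z) + h (bd z) = z + T z \<and> (\<forall>x. vertex x \<longrightarrow> h z x = 0) \<and>
       (\<forall>x\<in>supp (T z). \<forall>k\<in>S. x k = a k))"
  using \<open>finite S\<close>
proof (induction S rule: finite_induct)
  case empty
  show ?case
    by (rule exI[of _ "\<lambda>_. 0"], rule exI[of _ "\<lambda>z. z"])
       (simp add: Modules.additive_def preserves_def flip: zero_fun_def)
next
  case (insert k S)
  obtain h T where add: "Modules.additive h" "Modules.additive T"
    and pres: "preserves {a..b} h" "preserves {a..b} T"
    and eq: "\<And>z. supp z \<subseteq> {a..b} \<Longrightarrow> bd (h z) + h (bd z) = z + T z"
    and hv: "\<And>z x. supp z \<subseteq> {a..b} \<Longrightarrow> vertex x \<Longrightarrow> h z x = 0"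
    and TS: "\<And>z x k. supp z \<subseteq> {a..b} \<Longrightarrow> x \<in> supp (T z) \<Longrightarrow> k \<in> S \<Longrightarrow> x k = a k"
    using insert.IH by blast
  let ?H = "hk k (a k) (b k)" and ?P = "pk k (a k) (b k)"
  have ev: "even (a k)" "even (b k)"
    using v by (auto simp: vertex_def)
  have pb: "preserves {a..b} bd"
    by (intro preserves_bd face_closed_box v)
  have presH: "preserves {a..b} ?H"
    unfolding preserves_def
  proof (intro allI impI subsetI)
    fix z :: "'n cell chain" and x assume z: "supp z \<subseteq> {a..b}" and "x \<in> supp (?H z)"
    then obtain j where j: "x(k := j) \<in> supp z" "a k < x k" "x k < j" "j \<le> b k"
      by (auto elim: supp_hkE)
    then show "x \<in> {a..b}"
      using z by (intro upd_box_trans[of x k j]) auto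
  qed
  have presP: "preserves {a..b} ?P"
    unfolding preserves_def
  proof (intro allI impI subsetI)
    fix z :: "'n cell chain" and x assume z: "supp z \<subseteq> {a..b}" and "x \<in> supp (?P z)"
    then obtain j where j: "x(k := j) \<in> supp z" "x k = a k" "a k \<le> j" "j \<le> b k"
      by (auto elim: supp_pkE)
    then show "x \<in> {a..b}"
      using z by (intro upd_box_trans[of x k j]) auto
  qed
  \<comment> \<open>Concatenation of the homotopy from the identity to \<open>T\<close> with the one
    from \<open>T\<close> to \<open>?P \<circ> T\<close>.\<close>
  define h' where "h' z = h z + ?H (T z)" for z
  define T' where "T' = ?P \<circ> T"
  have 1: "Modules.additive h'"
    unfolding h'_def using additive_plus[OF add(1) additive_comp[OF additive_hk add(2)]]
    by (simp add: comp_def)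
  have 2: "Modules.additive T'"
    unfolding T'_def by (intro additive_comp additive_pk add)
  have 3: "preserves {a..b} h'"
    unfolding preserves_def
  proof (intro allI impI)
    fix z :: "'n cell chain" assume "supp z \<subseteq> {a..b}"
    then have "supp (h z) \<subseteq> {a..b}" "supp (?H (T z)) \<subseteq> {a..b}"
      using pres presH by (auto simp: preserves_def)
    then show "supp (h' z) \<subseteq> {a..b}"
      using supp_add[of "h z" "?H (T z)"] unfolding h'_def by blast
  qed
  have 4: "preserves {a..b} T'"
    unfolding T'_def by (intro preserves_comp presP pres)
  have 5: "bd (h' z) + h' (bd z) = z + T' z" if z: "supp z \<subseteq> {a..b}" for z
  proof -
    have bz: "supp (bd z) \<subseteq> {a..b}" and Tz: "supp (T z) \<subseteq> {a..b}"
      using z pb pres by (auto simp: preserves_def)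
    \<comment> \<open>That \<open>T\<close> is a chain map follows from the homotopy identity:
      evaluating it at \<open>bd z\<close> and applying \<open>bd\<close> to it at \<open>z\<close>
      give two expressions for \<open>bd (h (bd z))\<close>.\<close>
    have "bd (h (bd z)) = bd z + T (bd z)"
      using eq[OF bz] Modules.additive.zero[OF add(1)] by simp
    moreover have "bd (h (bd z)) = bd z + bd (T z)"
      using arg_cong[OF eq[OF z], of bd] by (simp add: bd_add)
    ultimately have Tbd: "T (bd z) = bd (T z)"
      by (metis add_left_cancel)
    have "a k \<le> x k \<and> x k \<le> b k" if "T z x \<noteq> 0" for x
      using Tz that by (auto simp: supp_def le_fun_def)
    then have "bd (?H (T z)) + ?H (bd (T z)) = T z + ?P (T z)"
      by (intro bd_hk ev)
    then have "bd (h' z) + h' (bd z) = (z + T z) + (T z + ?P (T z))"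
      unfolding h'_def by (simp add: bd_add Tbd add_ac flip: eq[OF z])
    then show ?thesis
      by (simp add: T'_def add.assoc)
  qed
  have 6: "h' z x = 0" if "supp z \<subseteq> {a..b}" "vertex x" for z x
    using hv[OF that] that(2) by (simp add: h'_def hk_def vertex_def)
  have 7: "x l = a l" if "supp z \<subseteq> {a..b}" "x \<in> supp (T' z)" "l \<in> insert k S" for z x l
  proof -
    obtain j where "x(k := j) \<in> supp (T z)" "x k = a k"
      using \<open>x \<in> supp (T' z)\<close> unfolding T'_def by (auto elim: supp_pkE)
    then show ?thesis
      using TS[OF that(1), of "x(k := j)" l] that(3) by (cases "l = k") auto
  qed
  show ?case
    by (rule exI[of _ h'], rule exI[of _ T'], intro conjI allI impI ballI)
       (rule 1 2 3 4 5 6 7; assumption)+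
qed

text \<open>With all coordinates collapsed, \<open>T z\<close> is a multiple of
  \<open>single a\<close>. The homotopy terms have augmentation 0, so the multiple is the
  augmentation of \<open>z\<close>.\<close>

lemma box_contraction:
  fixes a b :: "'n::finite cell"
  assumes v: "vertex a" "vertex b" and "a \<le> b"
  obtains h where "Modules.additive h" "preserves {a..b} h"
    "\<And>z x. supp z \<subseteq> {a..b} \<Longrightarrow> vertex x \<Longrightarrow> h z x = 0"
    "\<And>z. supp z \<subseteq> {a..b} \<Longrightarrow>
       bd (h z) + h (bd z) = z + (if eps {a..b} z = 0 then 0 else single a)"
proof -
  let ?B = "{a..b}"
  obtain h T where h: "Modules.additive h" "preserves ?B h"
    and T: "preserves ?B T"
    and eq: "\<And>z. supp z \<subseteq> ?B \<Longrightarrow> bd (h z) + h (bd z) = z + T z"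
    and hv: "\<And>z x. supp z \<subseteq> ?B \<Longrightarrow> vertex x \<Longrightarrow> h z x = 0"
    and TS: "\<And>z x k. supp z \<subseteq> ?B \<Longrightarrow> x \<in> supp (T z) \<Longrightarrow> x k = a k"
    using box_collapse[OF v, of UNIV] by auto
  have pb: "preserves ?B bd"
    by (intro preserves_bd face_closed_box v)
  have "T z = (if eps ?B z = 0 then 0 else single a)" if z: "supp z \<subseteq> ?B" for z
  proof -
    have "supp (h z) \<subseteq> ?B" "supp (bd z) \<subseteq> ?B"
      using z pb h by (auto simp: preserves_def)
    then have "eps ?B (bd (h z) + h (bd z)) = 0"
      using eps_bd[OF finite_box face_closed_box[OF v]] hv
      by (simp add: eps_add eps_eq_0)
    then have "eps ?B z = eps ?B (T z)"
      using eq[OF z] by (simp add: eps_add bit_add_eq_0_iff)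
    moreover have "T z = (if T z a = 0 then 0 else single a)"
    proof
      fix x
      have "T z x = 0" if "x \<noteq> a"
      proof (rule ccontr)
        assume "T z x \<noteq> 0"
        then have "x \<in> supp (T z)"
          by (simp add: supp_def)
        then have "x = a"
          by (intro ext TS[OF z])
        with that show False by simp
      qed
      then show "T z x = (if T z a = 0 then 0 else single a) x"
        by (cases "T z a") (auto simp: single_def)
    qed
    moreover have "eps ?B (single a) = 1"
      using v \<open>a \<le> b\<close> by (simp add: eps_single finite_box)
    ultimately show ?thesis
      by (metis eps_zero zero_neq_one)
  qed
  with h hv eq show thesis
    by (intro that[of h]) auto
qed

section \<open>Chain maps carried by boxes\<close>

lemma additive_eps_eq:
  assumes A: "Modules.additive A" and "finite (supp z)"
    and eq: "\<And>P. P \<in> supp z \<Longrightarrow> eps S (A (single P)) = eps S (single P)"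
  shows "eps S (A z) = eps S z"
proof -
  \<comment> \<open>Bits are viewed as chains on a one-point type, which makes
    \<open>additive_eqI\<close> applicable to the augmentation.\<close>
  have "(\<lambda>z (_::unit). eps S (A z)) z = (\<lambda>z (_::unit). eps S z) z"
    using assms(2)
    by (rule additive_eqI[rotated 2])
      (simp_all add: Modules.additive_def eps_add eq fun_eq_iff Modules.additive.add[OF A])
  then show ?thesis
    by (simp add: fun_eq_iff)
qed

definition dim_cell :: "'n::finite cell \<Rightarrow> nat" where
  "dim_cell Q = card {k. odd (Q k)}"

lemma dim_cell_eq_0: "dim_cell Q = 0 \<longleftrightarrow> vertex Q"
  by (auto simp: dim_cell_def vertex_def)

lemma dim_cell_face:
  assumes "even (P k)" "Q = P(k := P k + 1) \<or> Q = P(k := P k - 1)"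
  shows "dim_cell Q = Suc (dim_cell P)"
proof -
  have "{j. odd (Q j)} = insert k {j. odd (P j)}"
    using assms by (auto split: if_splits)
  then show ?thesis
    using assms(1) by (simp add: dim_cell_def)
qed

lemma face_dim:
  assumes "P \<in> supp (bd (single Q))"
  shows "dim_cell Q = Suc (dim_cell P)"
proof -
  obtain k where "even (P k)" "Q = P(k := P k + 1) \<or> Q = P(k := P k - 1)"
    using assms by (auto elim: supp_bdE)
  then show ?thesis
    by (rule dim_cell_face)
qed

lemma supp_eq_empty: "supp z = {} \<longleftrightarrow> z = 0"
  by (auto simp: supp_def fun_eq_iff)

lemma bd_single_vertex:
  assumes "vertex Q"
  shows "bd (single Q) = 0"
proof -
  have "supp (bd (single Q)) = {}"
    using face_dim[of _ Q] assms by (auto simp flip: dim_cell_eq_0)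
  then show ?thesis
    by (simp add: supp_eq_empty)
qed

text \<open>An acyclic carrier whose values are boxes: the boxes are contractible, and the box of a
  face lies in the box of the cell.\<close>

locale box_carrier =
  fixes lo hi :: "'n::finite cell \<Rightarrow> 'n cell"
  assumes vertex_lo: "vertex (lo Q)" and vertex_hi: "vertex (hi Q)" and lo_le_hi: "lo Q \<le> hi Q"
    and carrier_face: "\<And>P Q k. even (P k) \<Longrightarrow> Q = P(k := P k + 1) \<or> Q = P(k := P k - 1) \<Longrightarrow>
       lo Q \<le> lo P \<and> hi P \<le> hi Q"
begin

abbreviation carr :: "'n cell \<Rightarrow> 'n cell set" where
  "carr Q \<equiv> {lo Q..hi Q}"

lemma carr_face:
  assumes "P \<in> supp (bd (single Q))"
  shows "carr P \<subseteq> carr Q"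
proof -
  obtain k where "even (P k)" "Q = P(k := P k + 1) \<or> Q = P(k := P k - 1)"
    using assms by (auto elim: supp_bdE)
  then show ?thesis
    unfolding atLeastatMost_subset_iff using carrier_face by blast
qed

text \<open>The method of acyclic carriers: a vertex goes to a corner of its box; for a larger cell,
  the image of the boundary is a cycle of augmentation 0 in the box, and the contraction of the box
  fills it.\<close>

lemma chain_map_exists:
  assumes N: "finite N" "face_closed N" and carr: "\<And>Q. Q \<in> N \<Longrightarrow> carr Q \<subseteq> N"
  obtains \<phi> where "Modules.additive \<phi>"
    "\<And>Q. Q \<in> N \<Longrightarrow> supp (\<phi> (single Q)) \<subseteq> carr Q"
    "\<And>Q. Q \<in> N \<Longrightarrow> bd (\<phi> (single Q)) = \<phi> (bd (single Q))"
    "\<And>Q. Q \<in> N \<Longrightarrow> eps N (\<phi> (single Q)) = eps N (single Q)"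
proof -
  have "\<forall>Q. \<exists>h. Modules.additive h \<and> preserves (carr Q) h \<and>
     (\<forall>z. supp z \<subseteq> carr Q \<longrightarrow> (\<forall>x. vertex x \<longrightarrow> h z x = 0) \<and>
       bd (h z) + h (bd z) = z + (if eps (carr Q) z = 0 then 0 else single (lo Q)))"
    by (metis box_contraction[OF vertex_lo vertex_hi lo_le_hi])
  then obtain hh where hh_add: "\<And>Q. Modules.additive (hh Q)"
    and hh_pres: "\<And>Q. preserves (carr Q) (hh Q)"
    and hh_vertex: "\<And>Q z x. supp z \<subseteq> carr Q \<Longrightarrow> vertex x \<Longrightarrow> hh Q z x = 0"
    and hh_bd: "\<And>Q z. supp z \<subseteq> carr Q \<Longrightarrow>
        bd (hh Q z) + hh Q (bd z) = z + (if eps (carr Q) z = 0 then 0 else single (lo Q))"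
    by metis
  \<comment> \<open>The dimension is a separate recursion argument: \<open>ph d Q\<close> is
    meaningful when \<open>dim_cell Q = d\<close>, and the faces in the boundary of a cell of
    dimension \<open>Suc d\<close> have dimension \<open>d\<close>.\<close>
  define ph where "ph = rec_nat (\<lambda>Q. single (lo Q))
    (\<lambda>d f Q. hh Q (\<lambda>x. \<Sum>P\<in>N. bd (single Q) P * f P x))"
  define \<phi> where "\<phi> z = (\<lambda>x. \<Sum>P\<in>N. z P * ph (dim_cell P) P x)" for z
  have add: "Modules.additive \<phi>"
    by (simp add: Modules.additive_def \<phi>_def fun_eq_iff distrib_right sum.distrib)
  have \<phi>_zero: "\<phi> 0 = 0"
    by (rule Modules.additive.zero[OF add])
  have \<phi>_single: "\<phi> (single Q) = ph (dim_cell Q) Q" if "Q \<in> N" for Q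
  proof
    fix x
    have "\<phi> (single Q) x = (\<Sum>P\<in>N. if P = Q then ph (dim_cell Q) Q x else 0)"
      unfolding \<phi>_def by (intro sum.cong) (auto simp: single_def)
    then show "\<phi> (single Q) x = ph (dim_cell Q) Q x"
      using that N(1) by simp
  qed
  have \<phi>_vertex: "\<phi> (single Q) = single (lo Q)" if "Q \<in> N" "vertex Q" for Q
    using that \<phi>_single by (simp add: ph_def flip: dim_cell_eq_0)
  have \<phi>_cell: "\<phi> (single Q) = hh Q (\<phi> (bd (single Q)))" if Q: "Q \<in> N" "\<not> vertex Q" for Q
  proof -
    obtain d where d: "dim_cell Q = Suc d"
      using Q(2) by (metis dim_cell_eq_0 not0_implies_Suc)
    have "(\<lambda>x. \<Sum>P\<in>N. bd (single Q) P * ph d P x) = \<phi> (bd (single Q))"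
      unfolding \<phi>_def
    proof (intro ext sum.cong refl)
      fix x P assume "P \<in> N"
      show "bd (single Q) P * ph d P x = bd (single Q) P * ph (dim_cell P) P x"
        using face_dim[of P Q] d by (cases "bd (single Q) P = 0") (auto simp: supp_def)
    qed
    then show ?thesis
      using Q(1) d by (simp add: \<phi>_single ph_def)
  qed
  have pN: "preserves N bd"
    by (rule preserves_bd) fact
  have main: "supp (\<phi> (single Q)) \<subseteq> carr Q \<and> bd (\<phi> (single Q)) = \<phi> (bd (single Q)) \<and>
      eps N (\<phi> (single Q)) = eps N (single Q)" if "Q \<in> N" for Q
    using that
  proof (induction "dim_cell Q" arbitrary: Q rule: less_induct)
    case less
    show ?case
    proof (cases "vertex Q")
      case True
      moreover have "lo Q \<in> N"
        using carr[OF less.prems] lo_le_hi by auto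
      ultimately show ?thesis
        using less.prems N(1) lo_le_hi
        by (simp add: \<phi>_vertex \<phi>_zero bd_single_vertex vertex_lo eps_single)
    next
      case False
      let ?b = "bd (single Q)"
      let ?c = "\<phi> ?b"
      have bN: "supp ?b \<subseteq> N"
        using pN less.prems by (simp add: preserves_def)
      then have fin: "finite (supp ?b)"
        using N(1) by (rule finite_subset)
      have IH: "supp (\<phi> (single P)) \<subseteq> carr P" "bd (\<phi> (single P)) = \<phi> (bd (single P))"
        "eps N (\<phi> (single P)) = eps N (single P)" if "P \<in> supp ?b" for P
        using less.hyps[of P] face_dim[OF that] that bN by auto
      have c: "supp ?c \<subseteq> carr Q"
        using IH(1) carr_face by (intro additive_supp[OF add fin]) blast
      have "(bd \<circ> \<phi>) ?b = (\<phi> \<circ> bd) ?b"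
        by (rule additive_eqI[OF additive_comp[OF additive_bd add] additive_comp[OF add additive_bd] fin])
          (simp add: IH(2))
      then have bdc: "bd ?c = 0"
        by (simp add: \<phi>_zero)
      \<comment> \<open>For an edge \<open>Q\<close> the cycle condition is vacuous; the
        augmentation is what removes the term \<open>single (lo Q)\<close> from the contraction
        formula.\<close>
      have "eps N ?c = eps N ?b"
        by (rule additive_eps_eq[OF add fin IH(3)])
      then have "eps N ?c = 0"
        using eps_bd[OF N, of "single Q"] less.prems by simp
      then have "eps (carr Q) ?c = 0"
        using eps_superset[OF N(1) carr[OF less.prems] c] by simp
      then have "bd (hh Q ?c) = ?c"
        using hh_bd[OF c] Modules.additive.zero[OF hh_add, of Q] by (simp add: bdc)
      moreover have "supp (hh Q ?c) \<subseteq> carr Q"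
        using hh_pres c by (simp add: preserves_def)
      moreover have "eps N (hh Q ?c) = 0"
        using hh_vertex[OF c] by (rule eps_eq_0)
      ultimately show ?thesis
        using False less.prems N(1) by (simp add: \<phi>_cell eps_single)
    qed
  qed
  show thesis
    using main by (intro that[OF add]) auto
qed

text \<open>The set-valued dynamics on cells; its iterates bound the supports of the iterates of a
  carried chain map.\<close>

definition step :: "'n cell set \<Rightarrow> 'n cell set" where
  "step S = (\<Union>Q\<in>S. carr Q)"

lemma step_mono: "S \<subseteq> T \<Longrightarrow> step S \<subseteq> step T"
  by (auto simp: step_def)

lemma step_UN: "step (\<Union>i\<in>I. F i) = (\<Union>i\<in>I. step (F i))"
  by (auto simp: step_def)

lemma face_closed_step: "face_closed (step S)"
  unfolding step_def by (intro face_closed_UN face_closed_box vertex_lo vertex_hi)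

end

text \<open>A Lefschetz trace formula: contracting the box to \<open>a\<close> splits the identity as
  \<open>bd \<circ> h + h \<circ> bd\<close> plus the projection to \<open>a\<close>, and the first two terms contribute
  equal traces.\<close>

lemma trace_chain_map_box:
  fixes a b :: "'n::finite cell"
  assumes v: "vertex a" "vertex b" "a \<le> b"
    and \<psi>: "Modules.additive \<psi>" "preserves {a..b} \<psi>"
    and comm: "\<And>z. supp z \<subseteq> {a..b} \<Longrightarrow> bd (\<psi> z) = \<psi> (bd z)"
    and aug: "eps {a..b} (\<psi> (single a)) = 1"
  shows "trace_on {a..b} \<psi> = 1"
proof -
  let ?B = "{a..b}"
  obtain h where h: "Modules.additive h" "preserves ?B h"
    and eq: "\<And>z. supp z \<subseteq> ?B \<Longrightarrow>
       bd (h z) + h (bd z) = z + (if eps ?B z = 0 then 0 else single a)"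
    using box_contraction[OF v] by metis
  have pb: "preserves ?B bd"
    by (intro preserves_bd face_closed_box v)
  define A where "A = \<psi> \<circ> h"
  have A: "Modules.additive A" "preserves ?B A"
    unfolding A_def by (intro additive_comp preserves_comp \<psi> h)+
  have "\<psi> (single Q) Q = (bd \<circ> A) (single Q) Q + (A \<circ> bd) (single Q) Q
      + (if vertex Q then \<psi> (single a) Q else 0)" if "Q \<in> ?B" for Q
  proof -
    let ?p = "if vertex Q then single a else 0"
    have sQ: "supp (single Q) \<subseteq> ?B" and "supp (h (single Q)) \<subseteq> ?B"
      using that h(2) by (auto simp: preserves_def)
    then have bdA: "bd (A (single Q)) = \<psi> (bd (h (single Q)))"
      by (simp add: A_def comm)
    have "bd (h (single Q)) + h (bd (single Q)) = single Q + ?p"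
      using eq[OF sQ] that by (simp add: eps_single finite_box)
    then have "single Q = bd (h (single Q)) + h (bd (single Q)) + ?p"
      by (simp add: add.assoc)
    then have "\<psi> (single Q) = \<psi> (bd (h (single Q)) + h (bd (single Q)) + ?p)"
      by (rule arg_cong)
    also have "\<dots> = bd (A (single Q)) + A (bd (single Q)) + (if vertex Q then \<psi> (single a) else 0)"
      unfolding bdA by (simp add: A_def Modules.additive.add[OF \<psi>(1)] Modules.additive.zero[OF \<psi>(1)])
    finally show ?thesis
      by simp
  qed
  then have "trace_on ?B \<psi> = trace_on ?B (bd \<circ> A) + trace_on ?B (A \<circ> bd)
      + (\<Sum>Q\<in>?B. if vertex Q then \<psi> (single a) Q else 0)"
    by (simp add: trace_on_def sum.distrib)
  also have "trace_on ?B (bd \<circ> A) = trace_on ?B (A \<circ> bd)"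
    by (intro trace_on_commute additive_bd A pb finite_box)
  \<comment> \<open>The projection sends every vertex to \<open>a\<close>, so its contribution is
    the vertex count of \<open>\<psi> (single a)\<close>.\<close>
  also have "(\<Sum>Q\<in>?B. if vertex Q then \<psi> (single a) Q else 0) = eps ?B (\<psi> (single a))"
    unfolding eps_def by (rule sum.inter_filter[OF finite_box, symmetric])
  finally show ?thesis
    using aug by simp
qed

section \<open>Cells contained in their own carrier\<close>

context box_carrier
begin

theorem fixed_cell:
  assumes v: "vertex a" "vertex b" "a \<le> b"
    and absorb: "\<And>k. m \<le> k \<Longrightarrow> (step ^^ k) {a..b} \<subseteq> {a..b}"
  shows "\<exists>Q\<in>{a..b}. Q \<in> carr Q"
proof -
  let ?B = "{a..b}"
  define N where "N = (\<Union>k. (step ^^ k) ?B)"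
  have BN: "?B \<subseteq> N"
    unfolding N_def using UN_upper[of 0 UNIV "\<lambda>k. (step ^^ k) ?B"] by simp
  have fin: "finite ((step ^^ k) ?B)" for k
    by (induction k) (auto simp: step_def finite_box)
  have fc: "face_closed ((step ^^ k) ?B)" for k
    by (cases k) (auto simp: face_closed_step face_closed_box v)
  \<comment> \<open>Only iterates before time \<open>m\<close> can leave the box, which makes the
    set of reachable cells finite.\<close>
  have "N \<subseteq> ?B \<union> (\<Union>k<m. (step ^^ k) ?B)"
  proof
    fix x assume "x \<in> N"
    then obtain k where "x \<in> (step ^^ k) ?B"
      by (auto simp: N_def)
    then show "x \<in> ?B \<union> (\<Union>k<m. (step ^^ k) ?B)"
      using absorb[of k] by (cases "k < m") auto
  qed
  then have N: "finite N"
    by (rule finite_subset) (auto simp: fin finite_box)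
  have N_fc: "face_closed N"
    unfolding N_def by (intro face_closed_UN fc)
  have stepN: "step N \<subseteq> N"
  proof -
    have "step ((step ^^ k) ?B) \<subseteq> N" for k
      unfolding N_def using UN_upper[of "Suc k" UNIV "\<lambda>k. (step ^^ k) ?B"] by simp
    then show ?thesis
      unfolding N_def step_UN by auto
  qed
  then have carrN: "carr Q \<subseteq> N" if "Q \<in> N" for Q
    using that by (auto simp: step_def)
  obtain \<phi> where add: "Modules.additive \<phi>"
    and supp: "\<And>Q. Q \<in> N \<Longrightarrow> supp (\<phi> (single Q)) \<subseteq> carr Q"
    and comm1: "\<And>Q. Q \<in> N \<Longrightarrow> bd (\<phi> (single Q)) = \<phi> (bd (single Q))"
    and aug1: "\<And>Q. Q \<in> N \<Longrightarrow> eps N (\<phi> (single Q)) = eps N (single Q)"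
    using chain_map_exists[OF N N_fc carrN] by blast
  have finz: "finite (supp z)" if "supp z \<subseteq> N" for z
    using that N by (rule finite_subset)
  have supp_step: "supp (\<phi> z) \<subseteq> step (supp z)" if "supp z \<subseteq> N" for z
  proof (rule additive_supp[OF add finz[OF that]])
    fix P assume "P \<in> supp z"
    with that supp[of P] show "supp (\<phi> (single P)) \<subseteq> step (supp z)"
      unfolding step_def by blast
  qed
  have \<phi>N: "preserves N \<phi>"
    unfolding preserves_def using supp_step step_mono stepN by blast
  have comm: "bd (\<phi> z) = \<phi> (bd z)" if "supp z \<subseteq> N" for z
  proof -
    have "(bd \<circ> \<phi>) z = (\<phi> \<circ> bd) z"
    proof (rule additive_eqI[OF additive_comp[OF additive_bd add] additive_comp[OF add additive_bd] finz[OF that]])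
      fix P assume "P \<in> supp z"
      with that show "(bd \<circ> \<phi>) (single P) = (\<phi> \<circ> bd) (single P)"
        using comm1[of P] by auto
    qed
    then show ?thesis by simp
  qed
  have aug: "eps N (\<phi> z) = eps N z" if "supp z \<subseteq> N" for z
  proof (rule additive_eps_eq[OF add finz[OF that]])
    fix P assume "P \<in> supp z"
    with that show "eps N (\<phi> (single P)) = eps N (single P)"
      using aug1[of P] by auto
  qed
  have powN: "supp ((\<phi> ^^ k) z) \<subseteq> N" if "supp z \<subseteq> N" for k z
    using preserves_funpow[OF \<phi>N] that by (simp add: preserves_def)
  have pow_step: "supp ((\<phi> ^^ k) z) \<subseteq> (step ^^ k) (supp z)" if "supp z \<subseteq> N" for k z
  proof (induction k)
    case (Suc k)
    have "supp (\<phi> ((\<phi> ^^ k) z)) \<subseteq> step (supp ((\<phi> ^^ k) z))"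
      by (rule supp_step[OF powN[OF that]])
    also have "\<dots> \<subseteq> step ((step ^^ k) (supp z))"
      by (rule step_mono[OF Suc])
    finally show ?case by simp
  qed simp
  have step_pow_mono: "(step ^^ k) S \<subseteq> (step ^^ k) T" if "S \<subseteq> T" for k S T
    using that by (induction k) (simp_all add: step_mono)
  have bdN: "preserves N bd"
    by (rule preserves_bd) fact
  have pow_comm: "bd ((\<phi> ^^ k) z) = (\<phi> ^^ k) (bd z)" if "supp z \<subseteq> N" for k z
    using comm[OF powN[OF that]] by (induction k) auto
  have pow_aug: "eps N ((\<phi> ^^ k) z) = eps N z" if "supp z \<subseteq> N" for k z
    using aug[OF powN[OF that]] by (induction k) auto
  \<comment> \<open>The trace is known to survive powers of two only, and \<open>2 ^ m\<close> is
    one that is at least \<open>m\<close>.\<close>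
  define M :: nat where "M = 2 ^ m"
  have "m \<le> M"
    unfolding M_def by (simp add: less_imp_le)
  have into_B: "supp ((\<phi> ^^ M) z) \<subseteq> ?B" if z: "supp z \<subseteq> N" "supp z \<subseteq> (step ^^ k) ?B" for z k
  proof -
    have "supp ((\<phi> ^^ M) z) \<subseteq> (step ^^ M) ((step ^^ k) ?B)"
      using pow_step[OF z(1)] step_pow_mono[OF z(2)] by blast
    also have "\<dots> = (step ^^ (M + k)) ?B"
      by (simp add: funpow_add)
    also have "\<dots> \<subseteq> ?B"
      using \<open>m \<le> M\<close> by (intro absorb) simp
    finally show ?thesis .
  qed
  have "trace_on N \<phi> = trace_on N (\<phi> ^^ M)"
    unfolding M_def by (rule trace_on_power[OF add \<phi>N N, symmetric])
  \<comment> \<open>The power maps every basis chain of \<open>N\<close> into the box, so cells of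
    \<open>N\<close> outside the box have diagonal entry 0.\<close>
  also have "\<dots> = trace_on ?B (\<phi> ^^ M)"
    unfolding trace_on_def
  proof (intro sum.mono_neutral_right N BN ballI)
    fix Q assume Q: "Q \<in> N - ?B"
    then obtain k where "Q \<in> (step ^^ k) ?B"
      by (auto simp: N_def)
    with Q have "supp ((\<phi> ^^ M) (single Q)) \<subseteq> ?B"
      by (intro into_B) auto
    then show "(\<phi> ^^ M) (single Q) Q = 0"
      using Q by (auto simp: supp_def)
  qed
  also have "\<dots> = 1"
  proof (rule trace_chain_map_box[OF v additive_funpow[OF add]])
    show pB: "preserves ?B (\<phi> ^^ M)"
      unfolding preserves_def using into_B[where k = 0] BN by auto
    show "bd ((\<phi> ^^ M) z) = (\<phi> ^^ M) (bd z)" if "supp z \<subseteq> ?B" for z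
      using that BN by (intro pow_comm) blast
    have aB: "supp (single a) \<subseteq> ?B"
      using v by simp
    then have "eps ?B ((\<phi> ^^ M) (single a)) = eps N ((\<phi> ^^ M) (single a))"
      using pB by (intro eps_superset[OF N BN, symmetric]) (simp add: preserves_def)
    also have "\<dots> = eps N (single a)"
      using aB BN by (intro pow_aug) blast
    also have "\<dots> = 1"
      using v BN N by (subst eps_single) auto
    finally show "eps ?B ((\<phi> ^^ M) (single a)) = 1" .
  qed
  finally have "(\<Sum>Q\<in>N. \<phi> (single Q) Q) \<noteq> 0"
    by (simp add: trace_on_def)
  then obtain Q where "Q \<in> N" "\<phi> (single Q) Q \<noteq> 0"
    by (rule sum.not_neutral_contains_not_neutral)
  then have "Q \<in> carr Q"
    using supp[of Q] by (auto simp: supp_def)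
  moreover obtain k where "Q \<in> (step ^^ k) ?B"
    using \<open>Q \<in> N\<close> by (auto simp: N_def)
  \<comment> \<open>A cell in its own carrier stays reachable at all later times, so absorption puts
    it into the box.\<close>
  ultimately have reach: "Q \<in> (step ^^ (j + k)) ?B" for j
    by (induction j) (auto simp: step_def)
  have "Q \<in> ?B"
    by (rule subsetD[OF absorb[OF le_add1] reach])
  with \<open>Q \<in> carr Q\<close> show ?thesis by blast
qed

end

section \<open>The dynamics\<close>

lemma continuous_on_funpow:
  fixes f :: "'a::topological_space \<Rightarrow> 'a"
  assumes "continuous_on UNIV f"
  shows "continuous_on UNIV (f ^^ k)"
proof (induction k)
  case (Suc k)
  then show ?case
    using continuous_on_compose[of UNIV "f ^^ k" f] continuous_on_subset[OF assms]
    by simp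
qed (simp add: id_def)

text \<open>The open preimages of \<open>U\<close> under the iterates cover \<open>C\<close>; the
  bound is the largest exponent of a finite subcover.\<close>

lemma compact_uniform_hitting_time:
  fixes f :: "'a::topological_space \<Rightarrow> 'a"
  assumes f: "continuous_on UNIV f" and "compact C" "open U"
    and hit: "\<And>x. x \<in> C \<Longrightarrow> \<exists>k\<ge>j. (f ^^ k) x \<in> U"
  obtains m where "\<And>x. x \<in> C \<Longrightarrow> \<exists>k\<ge>j. k \<le> m \<and> (f ^^ k) x \<in> U"
proof -
  have "open ((f ^^ k) -` U)" for k
    using continuous_on_funpow[OF f] \<open>open U\<close> by (simp add: continuous_on_open_vimage)
  moreover have "C \<subseteq> (\<Union>k\<in>{j..}. (f ^^ k) -` U)"
    using hit by fastforce
  ultimately obtain I where I: "I \<subseteq> {j..}" "finite I" "C \<subseteq> (\<Union>k\<in>I. (f ^^ k) -` U)"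
    using compactE_image[OF \<open>compact C\<close>] by metis
  show thesis
  \<comment> \<open>Inserting 0 covers the case of an empty subcover.\<close>
  proof (rule that[of "Max (insert 0 I)"])
    fix x assume "x \<in> C"
    then obtain k where "k \<in> I" "(f ^^ k) x \<in> U"
      using I(3) by auto
    then show "\<exists>k\<ge>j. k \<le> Max (insert 0 I) \<and> (f ^^ k) x \<in> U"
      using I(1,2) by (intro exI[of _ k]) auto
  qed
qed

section \<open>Absorbing cubes\<close>

abbreviation cube :: "nat \<Rightarrow> (real ^ 'n) set" where
  "cube L \<equiv> cbox (\<chi> i. - real L) (\<chi> i. real L)"

abbreviation open_cube :: "nat \<Rightarrow> (real ^ 'n) set" where
  "open_cube L \<equiv> box (\<chi> i. - real L) (\<chi> i. real L)"

lemma bounded_subset_open_cube: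
  fixes K :: "(real ^ 'n) set"
  assumes "bounded K"
  obtains L where "K \<subseteq> open_cube L"
proof -
  obtain r where r: "\<And>x. x \<in> K \<Longrightarrow> norm x \<le> r"
    using assms by (auto simp: bounded_iff)
  obtain L where L: "r < real L"
    using reals_Archimedean2 by blast
  have "x \<in> open_cube L" if "x \<in> K" for x
  proof -
    have "\<bar>x $ i\<bar> < real L" for i
      using component_le_norm_cart[of x i] r[OF that] L by linarith
    then show ?thesis
      by (simp add: mem_box_cart abs_less_iff minus_less_iff)
  qed
  then show thesis
    by (intro that) blast
qed

text \<open>The window is enlarged to an open ball so that hitting times are locally bounded. Orbits
  starting in the closed ball stay in a compact set \<open>K\<close>; a cube around \<open>K\<close>
  then has all its points in \<open>K\<close> after a uniform time.\<close>

lemma absorbing_cube: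
  fixes f :: "real ^ 'n \<Rightarrow> real ^ 'n"
  assumes f: "continuous_on UNIV f" and "compact W" and window: "\<And>x. \<exists>k. (f ^^ k) x \<in> W"
  obtains L m where "\<And>k x. m \<le> k \<Longrightarrow> x \<in> cube L \<Longrightarrow> (f ^^ k) x \<in> open_cube L"
proof -
  obtain r where "0 < r" and r: "W \<subseteq> ball 0 r"
    using bounded_subset_ballD[OF compact_imp_bounded[OF \<open>compact W\<close>]] by blast
  let ?U = "ball (0 :: real ^ 'n) r" and ?D = "cball (0 :: real ^ 'n) r"
  \<comment> \<open>Applying the window property to \<open>f x\<close> gives a return after at least
    one step, so the induction on time below descends.\<close>
  have "\<exists>k\<ge>1. (f ^^ k) x \<in> ?U" for x
  proof -
    obtain k where "(f ^^ k) (f x) \<in> W"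
      using window by blast
    then have "(f ^^ Suc k) x \<in> ?U"
      using r by (auto simp: funpow_swap1)
    then show ?thesis
      by (intro exI[of _ "Suc k"]) simp
  qed
  then obtain m0 where m0: "\<And>x. x \<in> ?D \<Longrightarrow> \<exists>k\<ge>1. k \<le> m0 \<and> (f ^^ k) x \<in> ?U"
    using compact_uniform_hitting_time[OF f compact_cball open_ball] by metis
  define K where "K = (\<Union>k\<le>m0. (f ^^ k) ` ?D)"
  \<comment> \<open>Each orbit from the closed ball is back in the ball within \<open>m0\<close>
    steps, so longer times reduce to shorter ones.\<close>
  have invariant: "(f ^^ k) x \<in> K" if "x \<in> ?D" for k x
    using that
  proof (induction k arbitrary: x rule: less_induct)
    case (less k)
    show ?case
    proof (cases "k \<le> m0")
      case True
      then show ?thesis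
        unfolding K_def using less.prems by blast
    next
      case False
      obtain j where j: "1 \<le> j" "j \<le> m0" "(f ^^ j) x \<in> ?U"
        using m0[OF less.prems] by blast
      have "(f ^^ (k - j)) ((f ^^ j) x) \<in> K"
        using j False by (intro less.IH) auto
      then have "(f ^^ (k - j + j)) x \<in> K"
        by (simp only: funpow_add comp_apply)
      then show ?thesis
        using j False by simp
    qed
  qed
  have "compact K"
    unfolding K_def
    by (intro compact_UN finite_atMost compact_continuous_image compact_cball
        continuous_on_subset[OF continuous_on_funpow[OF f]]) auto
  then obtain L where L: "K \<subseteq> open_cube L"
    using bounded_subset_open_cube compact_imp_bounded by blast
  have "\<exists>k\<ge>0. (f ^^ k) x \<in> ?U" for x
    using window[of x] r by blast
  then obtain m where m: "\<And>x. x \<in> cube L \<Longrightarrow> \<exists>k\<ge>0. k \<le> m \<and> (f ^^ k) x \<in> ?U"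
    using compact_uniform_hitting_time[OF f compact_cbox open_ball] by metis
  show thesis
  proof (rule that[of m L])
    fix k and x :: "real ^ 'n" assume "m \<le> k" and x: "x \<in> cube L"
    obtain j where j: "j \<le> m" "(f ^^ j) x \<in> ?U"
      using m[OF x] by blast
    have "(f ^^ (k - j)) ((f ^^ j) x) \<in> K"
      using j by (intro invariant) auto
    then have "(f ^^ (k - j + j)) x \<in> K"
      by (simp only: funpow_add comp_apply)
    then show "(f ^^ k) x \<in> open_cube L"
      using L j \<open>m \<le> k\<close> by auto
  qed
qed

text \<open>The grid hull of an image is bounded coordinate by coordinate, with extrema attained at
  different points; hence separate witnesses \<open>y\<close> and \<open>y'\<close> for every
  \<open>i\<close>.\<close>

definition approx :: "(real ^ 'n \<Rightarrow> real ^ 'n) \<Rightarrow> real \<Rightarrow> real ^ 'n \<Rightarrow> real ^ 'n \<Rightarrow> bool" where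
  "approx f r x x' \<longleftrightarrow> (\<forall>i. \<exists>y y'. dist y x \<le> r \<and> dist y' x \<le> r \<and>
     f y $ i - r \<le> x' $ i \<and> x' $ i \<le> f y' $ i + r)"

text \<open>The witnesses converge to \<open>x\<close>, so continuity squeezes each coordinate of
  \<open>v n\<close>.\<close>

lemma approx_tendsto:
  fixes f :: "real ^ 'n \<Rightarrow> real ^ 'n"
  assumes f: "continuous_on UNIV f" and r: "r \<longlonglongrightarrow> 0" and u: "u \<longlonglongrightarrow> x"
    and app: "\<And>n. approx f (r n) (u n) (v n)"
  shows "v \<longlonglongrightarrow> f x"
proof (rule vec_tendstoI)
  fix i
  have "\<forall>n. \<exists>y y'. dist y (u n) \<le> r n \<and> dist y' (u n) \<le> r n \<and>
      f y $ i - r n \<le> v n $ i \<and> v n $ i \<le> f y' $ i + r n"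
    using app by (simp add: approx_def)
  then obtain y y' where y: "\<And>n. dist (y n) (u n) \<le> r n" "\<And>n. dist (y' n) (u n) \<le> r n"
    and le: "\<And>n. f (y n) $ i - r n \<le> v n $ i" "\<And>n. v n $ i \<le> f (y' n) $ i + r n"
    by metis
  have lim: "(\<lambda>n. f (w n) $ i) \<longlonglongrightarrow> f x $ i" if w: "\<And>n. dist (w n) (u n) \<le> r n" for w
  proof -
    have "(\<lambda>n. dist (w n) (u n)) \<longlonglongrightarrow> 0"
      using w by (intro tendsto_sandwich[OF _ _ tendsto_const r]) auto
    then have "(\<lambda>n. w n - u n) \<longlonglongrightarrow> 0"
      by (simp add: dist_norm tendsto_norm_zero_iff)
    then have "w \<longlonglongrightarrow> x"
      using tendsto_add[OF _ u, of "\<lambda>n. w n - u n" 0] by simp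
    then show ?thesis
      using f by (intro tendsto_vec_nth) (auto intro: continuous_on_tendsto_compose)
  qed
  show "(\<lambda>n. v n $ i) \<longlonglongrightarrow> f x $ i"
  proof (rule tendsto_sandwich)
    show "(\<lambda>n. f (y n) $ i - r n) \<longlonglongrightarrow> f x $ i"
      using tendsto_diff[OF lim[OF y(1)] r] by simp
    show "(\<lambda>n. f (y' n) $ i + r n) \<longlonglongrightarrow> f x $ i"
      using tendsto_add[OF lim[OF y(2)] r] by simp
  qed (use le in auto)
qed

section \<open>Grids of mesh 1 / N\<close>

text \<open>The two quotients are the floor and the ceiling of \<open>Q i / 2\<close>: they agree
  for even \<open>Q i\<close> and are consecutive for odd \<open>Q i\<close>.\<close>

definition cell_set :: "nat \<Rightarrow> 'n::finite cell \<Rightarrow> (real ^ 'n) set" where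
  "cell_set N Q = cbox (\<chi> i. of_int (Q i div 2) / N) (\<chi> i. of_int ((Q i + 1) div 2) / N)"

definition midpt :: "nat \<Rightarrow> 'n::finite cell \<Rightarrow> real ^ 'n" where
  "midpt N Q = (\<chi> i. of_int (Q i) / (2 * N))"

text \<open>With \<open>grid_hi\<close>, this spans the grid hull: the bounding box of the image is
  rounded outwards to multiples of \<open>1 / N\<close>, and the factor 2 encodes these as
  vertices.\<close>

definition grid_lo :: "(real ^ 'n \<Rightarrow> real ^ 'n) \<Rightarrow> nat \<Rightarrow> 'n::finite cell \<Rightarrow> 'n cell" where
  "grid_lo f N Q = (\<lambda>i. 2 * \<lfloor>N * (INF y\<in>cell_set N Q. f y $ i)\<rfloor>)"

definition grid_hi :: "(real ^ 'n \<Rightarrow> real ^ 'n) \<Rightarrow> nat \<Rightarrow> 'n::finite cell \<Rightarrow> 'n cell" where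
  "grid_hi f N Q = (\<lambda>i. 2 * \<lceil>N * (SUP y\<in>cell_set N Q. f y $ i)\<rceil>)"

lemma half_bounds:
  fixes q :: int
  shows "of_int (q div 2) \<le> of_int q / (2::real)" "of_int q / (2::real) \<le> of_int ((q + 1) div 2)"
    "of_int ((q + 1) div 2) \<le> of_int (q div 2) + (1::real)"
proof -
  have "2 * (q div 2) \<le> q" "q \<le> 2 * ((q + 1) div 2)" "(q + 1) div 2 \<le> q div 2 + 1"
    by presburger+
  then have "real_of_int (2 * (q div 2)) \<le> of_int q" "real_of_int q \<le> of_int (2 * ((q + 1) div 2))"
    "real_of_int ((q + 1) div 2) \<le> of_int (q div 2 + 1)"
    by (simp_all only: of_int_le_iff)
  then show "of_int (q div 2) \<le> of_int q / (2::real)" "of_int q / (2::real) \<le> of_int ((q + 1) div 2)"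
    "of_int ((q + 1) div 2) \<le> of_int (q div 2) + (1::real)"
    by simp_all
qed

lemma midpt_in_cell: "midpt N Q \<in> cell_set N Q"
proof -
  have "of_int (Q i div 2) / real N \<le> of_int (Q i) / 2 / real N \<and>
      of_int (Q i) / 2 / real N \<le> of_int ((Q i + 1) div 2) / real N" for i
    by (intro conjI divide_right_mono half_bounds) simp_all
  then show ?thesis
    by (simp add: cell_set_def midpt_def mem_box_cart)
qed

text \<open>Every coordinate differs by at most \<open>1 / N\<close>, and the norm is at most the
  sum of the absolute coordinates.\<close>

lemma dist_cell_midpt:
  fixes Q :: "'n::finite cell"
  assumes N: "N > 0" and y: "y \<in> cell_set N Q"
  shows "dist y (midpt N Q) \<le> CARD('n) / N"
proof -
  have "\<bar>(y - midpt N Q) $ i\<bar> \<le> 1 / N" for i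
  proof -
    have "of_int (Q i div 2) / N \<le> y $ i" "y $ i \<le> of_int ((Q i + 1) div 2) / N"
      using y by (auto simp: cell_set_def mem_box_cart)
    then have "of_int (Q i div 2) \<le> N * y $ i" "N * y $ i \<le> of_int ((Q i + 1) div 2)"
      using N by (simp_all add: field_simps)
    then have "\<bar>N * y $ i - of_int (Q i) / 2\<bar> \<le> 1"
      using half_bounds[of "Q i"] by linarith
    moreover have "N * y $ i - of_int (Q i) / 2 = N * (y - midpt N Q) $ i"
      using N by (simp add: midpt_def field_simps)
    ultimately have "N * \<bar>(y - midpt N Q) $ i\<bar> \<le> 1"
      by (metis abs_mult abs_of_nat)
    then show ?thesis
      using N by (simp only: pos_le_divide_eq of_nat_0_less_iff mult.commute)
  qed
  then have "(\<Sum>i\<in>UNIV. \<bar>(y - midpt N Q) $ i\<bar>) \<le> (\<Sum>i\<in>(UNIV :: 'n set). 1 / N)"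
    by (intro sum_mono)
  then show ?thesis
    using norm_le_l1_cart[of "y - midpt N Q"] by (simp add: dist_norm)
qed

lemma cell_set_face:
  fixes P :: "'n::finite cell"
  assumes "even (P k)" "Q = P(k := P k + 1) \<or> Q = P(k := P k - 1)"
  shows "cell_set N P \<subseteq> cell_set N Q"
proof -
  have coord: "Q i div 2 \<le> P i div 2 \<and> (P i + 1) div 2 \<le> (Q i + 1) div 2" for i
  proof (cases "i = k")
    case True
    then have "Q i = P i + 1 \<or> Q i = P i - 1" "even (P i)"
      using assms by auto
    then show ?thesis by presburger
  next
    case False
    then show ?thesis using assms by auto
  qed
  show ?thesis
  proof
    fix y assume y: "y \<in> cell_set N P"
    have "of_int (Q i div 2) / real N \<le> y $ i \<and> y $ i \<le> of_int ((Q i + 1) div 2) / real N" for i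
    proof -
      have "of_int (Q i div 2) / real N \<le> of_int (P i div 2) / real N"
        "of_int ((P i + 1) div 2) / real N \<le> of_int ((Q i + 1) div 2) / real N"
        using coord[of i] by (simp_all add: divide_right_mono)
      moreover have "of_int (P i div 2) / real N \<le> y $ i" "y $ i \<le> of_int ((P i + 1) div 2) / real N"
        using y by (auto simp: cell_set_def mem_box_cart)
      ultimately show ?thesis
        by linarith
    qed
    then show "y \<in> cell_set N Q"
      by (simp add: cell_set_def mem_box_cart)
  qed
qed

lemma cell_component_bounds:
  fixes f :: "real ^ 'n \<Rightarrow> real ^ 'n"
  assumes f: "continuous_on UNIV f"
  obtains y y' where "y \<in> cell_set N Q" "y' \<in> cell_set N Q"
    "(INF y\<in>cell_set N Q. f y $ i) = f y $ i" "(SUP y\<in>cell_set N Q. f y $ i) = f y' $ i"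
    "bdd_below ((\<lambda>y. f y $ i) ` cell_set N Q)" "bdd_above ((\<lambda>y. f y $ i) ` cell_set N Q)"
proof -
  have "compact (cell_set N Q)" "cell_set N Q \<noteq> {}"
    using midpt_in_cell[of N Q] by (auto simp: cell_set_def)
  moreover have "continuous_on (cell_set N Q) (\<lambda>y. f y $ i)"
    using continuous_on_subset[OF f] by (intro continuous_on_component) auto
  ultimately obtain y y' where y: "y \<in> cell_set N Q" "y' \<in> cell_set N Q"
    and le: "\<forall>z\<in>cell_set N Q. f y $ i \<le> f z $ i" "\<forall>z\<in>cell_set N Q. f z $ i \<le> f y' $ i"
    using continuous_attains_inf continuous_attains_sup by metis
  show thesis
  proof (rule that[OF y])
    show "(INF y\<in>cell_set N Q. f y $ i) = f y $ i"
      using y le by (intro cInf_eq_minimum) auto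
    show "(SUP y\<in>cell_set N Q. f y $ i) = f y' $ i"
      using y le by (intro cSup_eq_maximum) auto
  qed (use le in \<open>auto intro: bdd_belowI2 bdd_aboveI2\<close>)
qed

lemma box_carrier_grid:
  fixes f :: "real ^ 'n \<Rightarrow> real ^ 'n"
  assumes f: "continuous_on UNIV f"
  shows "box_carrier (grid_lo f N) (grid_hi f N)"
proof
  show "vertex (grid_lo f N Q)" "vertex (grid_hi f N Q)" for Q
    by (simp_all add: vertex_def grid_lo_def grid_hi_def)
  show "grid_lo f N Q \<le> grid_hi f N Q" for Q
    unfolding le_fun_def
  proof
    fix i
    obtain y y' where *: "y \<in> cell_set N Q" "(INF y\<in>cell_set N Q. f y $ i) = f y $ i"
      "(SUP y\<in>cell_set N Q. f y $ i) = f y' $ i" "bdd_above ((\<lambda>y. f y $ i) ` cell_set N Q)"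
      by (rule cell_component_bounds[OF f])
    then have "f y $ i \<le> f y' $ i"
      using cSUP_upper[OF *(1,4)] by simp
    then have "real N * f y $ i \<le> real N * f y' $ i"
      by (intro mult_left_mono) auto
    then have "\<lfloor>N * f y $ i\<rfloor> \<le> \<lceil>N * f y' $ i\<rceil>"
      by linarith
    then show "grid_lo f N Q i \<le> grid_hi f N Q i"
      by (simp add: grid_lo_def grid_hi_def *)
  qed
  fix P Q :: "'n cell" and k
  assume PQ: "even (P k)" "Q = P(k := P k + 1) \<or> Q = P(k := P k - 1)"
  have sub: "cell_set N P \<subseteq> cell_set N Q" and ne: "cell_set N P \<noteq> {}"
    using cell_set_face[OF PQ] midpt_in_cell[of N P] by auto
  have "(INF y\<in>cell_set N Q. f y $ i) \<le> (INF y\<in>cell_set N P. f y $ i) \<and>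
      (SUP y\<in>cell_set N P. f y $ i) \<le> (SUP y\<in>cell_set N Q. f y $ i)" for i
  proof -
    obtain y y' where "bdd_below ((\<lambda>y. f y $ i) ` cell_set N Q)" "bdd_above ((\<lambda>y. f y $ i) ` cell_set N Q)"
      by (rule cell_component_bounds[OF f])
    then show ?thesis
      using sub ne by (intro conjI cINF_superset_mono cSUP_subset_mono) auto
  qed
  then show "grid_lo f N Q \<le> grid_lo f N P \<and> grid_hi f N P \<le> grid_hi f N Q"
    by (auto simp: le_fun_def grid_lo_def grid_hi_def intro!: floor_mono ceiling_mono mult_left_mono)
qed

lemma grid_carrier_approx:
  fixes f :: "real ^ 'n \<Rightarrow> real ^ 'n"
  assumes f: "continuous_on UNIV f" and N: "N > 0" and Q': "Q' \<in> {grid_lo f N Q..grid_hi f N Q}"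
  shows "approx f (CARD('n) / N) (midpt N Q) (midpt N Q')"
  unfolding approx_def
proof
  fix i
  obtain y y' where y: "y \<in> cell_set N Q" "y' \<in> cell_set N Q"
    and eq: "(INF y\<in>cell_set N Q. f y $ i) = f y $ i" "(SUP y\<in>cell_set N Q. f y $ i) = f y' $ i"
    by (rule cell_component_bounds[OF f])
  have "grid_lo f N Q i \<le> Q' i" "Q' i \<le> grid_hi f N Q i"
    using Q' by (auto simp: le_fun_def)
  then have "2 * \<lfloor>N * f y $ i\<rfloor> \<le> Q' i" "Q' i \<le> 2 * \<lceil>N * f y' $ i\<rceil>"
    by (simp_all add: grid_lo_def grid_hi_def eq)
  then have "N * f y $ i - 1 \<le> of_int (Q' i) / 2" "of_int (Q' i) / 2 \<le> N * f y' $ i + 1"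
    by linarith+
  moreover have "of_int (Q' i) / 2 = N * midpt N Q' $ i"
    using N by (simp add: midpt_def)
  ultimately have "f y $ i - 1 / N \<le> midpt N Q' $ i" "midpt N Q' $ i \<le> f y' $ i + 1 / N"
    using N by (simp_all add: field_simps)
  \<comment> \<open>Rounding costs \<open>1 / N\<close>; it is enlarged to let one radius serve both
    the cell size and the rounding.\<close>
  moreover have "1 / N \<le> CARD('n) / N"
    by (intro divide_right_mono) (simp_all add: Suc_leI)
  ultimately have "f y $ i - CARD('n) / N \<le> midpt N Q' $ i \<and> midpt N Q' $ i \<le> f y' $ i + CARD('n) / N"
    by linarith
  then show "\<exists>y y'. dist y (midpt N Q) \<le> CARD('n) / N \<and> dist y' (midpt N Q) \<le> CARD('n) / N \<and>
      f y $ i - CARD('n) / N \<le> midpt N Q' $ i \<and> midpt N Q' $ i \<le> f y' $ i + CARD('n) / N"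
    using dist_cell_midpt[OF N y(1)] dist_cell_midpt[OF N y(2)] by blast
qed

text \<open>As \<open>L\<close> is an integer, the corners of the cube are vertices of every grid,
  and the geometric and combinatorial cubes match exactly.\<close>

lemma midpt_in_cube:
  assumes N: "N > 0"
  shows "midpt N Q \<in> cube L \<longleftrightarrow> Q \<in> {(\<lambda>_. - 2 * int L * int N)..(\<lambda>_. 2 * int L * int N)}"
proof -
  have "- real L \<le> of_int q / (2 * real N) \<longleftrightarrow> - 2 * int L * int N \<le> q" for q
  proof -
    have "- real L \<le> of_int q / (2 * real N) \<longleftrightarrow> of_int (- 2 * int L * int N) \<le> real_of_int q"
      using N by (simp add: field_simps)
    then show ?thesis by (simp only: of_int_le_iff)
  qed
  moreover have "of_int q / (2 * real N) \<le> real L \<longleftrightarrow> q \<le> 2 * int L * int N" for q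
  proof -
    have "of_int q / (2 * real N) \<le> real L \<longleftrightarrow> real_of_int q \<le> of_int (2 * int L * int N)"
      using N by (simp add: field_simps)
    then show ?thesis by (simp only: of_int_le_iff)
  qed
  ultimately show ?thesis
    by (simp add: mem_box_cart midpt_def le_fun_def all_conj_distrib)
qed

text \<open>This turns a combinatorial orbit into a pseudo-orbit of midpoints, to which limits of
  real points apply.\<close>

lemma grid_chain:
  fixes f :: "real ^ 'n \<Rightarrow> real ^ 'n"
  assumes f: "continuous_on UNIV f" and N: "N > 0"
    and Q: "Q \<in> (box_carrier.step (grid_lo f N) (grid_hi f N) ^^ k) S"
  obtains c where "c 0 \<in> midpt N ` S" "c k = midpt N Q"
    "\<And>j. j < k \<Longrightarrow> approx f (CARD('n) / N) (c j) (c (Suc j))"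
proof -
  interpret box_carrier "grid_lo f N" "grid_hi f N"
    by (rule box_carrier_grid[OF f])
  have "\<exists>c. c 0 \<in> midpt N ` S \<and> c k = midpt N Q \<and>
      (\<forall>j<k. approx f (CARD('n) / N) (c j) (c (Suc j)))"
    using Q
  proof (induction k arbitrary: Q)
    case 0
    then show ?case
      by (intro exI[of _ "\<lambda>_. midpt N Q"]) simp
  next
    case (Suc k)
    then have "Q \<in> step ((step ^^ k) S)"
      by simp
    then obtain P where P: "P \<in> (step ^^ k) S" and PQ: "Q \<in> carr P"
      unfolding step_def[of "(step ^^ k) S"] by blast
    obtain c where c: "c 0 \<in> midpt N ` S" "c k = midpt N P"
      "\<forall>j<k. approx f (CARD('n) / N) (c j) (c (Suc j))"
      using Suc.IH[OF P] by blast
    have "approx f (CARD('n) / N) (c k) (midpt N Q)"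
      unfolding c(2) by (rule grid_carrier_approx[OF f N PQ])
    then show ?case
      using c by (intro exI[of _ "c(Suc k := midpt N Q)"]) (auto simp: less_Suc_eq)
  qed
  then show thesis
    using that by blast
qed

text \<open>For a fixed length \<open>k\<close>, a subsequence of the starting points converges, and
  then the later points converge one after another to a true orbit.\<close>

lemma approx_chain_limit:
  fixes f :: "real ^ 'n \<Rightarrow> real ^ 'n"
  assumes f: "continuous_on UNIV f" and r: "r \<longlonglongrightarrow> 0" and "compact C" "closed F"
    and start: "\<And>n. c n 0 \<in> C" and finish: "\<And>n. c n k \<in> F"
    and app: "\<And>n j. j < k \<Longrightarrow> approx f (r n) (c n j) (c n (Suc j))"
  shows "\<exists>x\<in>C. (f ^^ k) x \<in> F"
proof -
  obtain x \<sigma> where x: "x \<in> C" "strict_mono \<sigma>" and lim: "((\<lambda>n. c n 0) \<circ> \<sigma>) \<longlonglongrightarrow> x"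
    using \<open>compact C\<close> start unfolding compact_def by meson
  have r\<sigma>: "(\<lambda>n. r (\<sigma> n)) \<longlonglongrightarrow> 0"
    using LIMSEQ_subseq_LIMSEQ[OF r x(2)] by (simp add: comp_def)
  have "j \<le> k \<Longrightarrow> (\<lambda>n. c (\<sigma> n) j) \<longlonglongrightarrow> (f ^^ j) x" for j
  proof (induction j)
    case 0
    then show ?case
      using lim by (simp add: comp_def)
  next
    case (Suc j)
    then have "(\<lambda>n. c (\<sigma> n) (Suc j)) \<longlonglongrightarrow> f ((f ^^ j) x)"
      using app by (intro approx_tendsto[OF f r\<sigma>]) auto
    then show ?case by simp
  qed
  then have "(\<lambda>n. c (\<sigma> n) k) \<longlonglongrightarrow> (f ^^ k) x"
    by simp
  then have "(f ^^ k) x \<in> F"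
    by (rule closed_sequentially[OF \<open>closed F\<close> finish])
  with x show ?thesis by blast
qed

section \<open>Absorption on fine grids\<close>

lemma tendsto_mesh:
  fixes c :: real
  assumes "\<And>i. N i > i" "c \<ge> 0"
  shows "(\<lambda>i. c / real (N i)) \<longlonglongrightarrow> 0"
proof (rule tendsto_sandwich[of "\<lambda>_. 0" _ _ "\<lambda>i. c / real (Suc i)"])
  have "c / real (N i) \<le> c / real (Suc i)" for i
    using assms(1)[of i] assms(2) by (intro divide_left_mono) auto
  then show "\<forall>\<^sub>F i in sequentially. c / real (N i) \<le> c / real (Suc i)"
    by simp
  show "(\<lambda>i. c / real (Suc i)) \<longlonglongrightarrow> 0"
    using tendsto_mult_right_zero[OF LIMSEQ_inverse_real_of_nat, of c] by (simp add: divide_inverse)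
qed (use assms in auto)

text \<open>The first \<open>m\<close> steps return to \<open>B\<close>, so \<open>m\<close> can be
  subtracted until the exponent is below \<open>2 * m\<close>. Thus finitely many exponents, and one
  grid, suffice.\<close>

lemma absorbed_of_interval:
  fixes g :: "'a set \<Rightarrow> 'a set"
  assumes mono: "\<And>S T. S \<subseteq> T \<Longrightarrow> g S \<subseteq> g T" and "m > 0"
    and abs: "\<And>k. k \<in> {m..<2 * m} \<Longrightarrow> (g ^^ k) B \<subseteq> B" and "m \<le> k"
  shows "(g ^^ k) B \<subseteq> B"
  using \<open>m \<le> k\<close>
proof (induction k rule: less_induct)
  case (less k)
  show ?case
  proof (cases "k < 2 * m")
    case True
    then show ?thesis using abs less.prems by simp
  next
    case False
    have pow_mono: "(g ^^ j) S \<subseteq> (g ^^ j) T" if "S \<subseteq> T" for j S T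
      using that by (induction j) (simp_all add: mono)
    have "(g ^^ k) B = (g ^^ (k - m)) ((g ^^ m) B)"
      using less.prems by (simp flip: funpow_add[unfolded comp_def, THEN fun_cong])
    also have "\<dots> \<subseteq> (g ^^ (k - m)) B"
      using \<open>m > 0\<close> by (intro pow_mono abs) simp
    also have "\<dots> \<subseteq> B"
      using False \<open>m > 0\<close> by (intro less.IH) auto
    finally show ?thesis .
  qed
qed

abbreviation cube_cells :: "nat \<Rightarrow> nat \<Rightarrow> 'n cell set" where
  "cube_cells L N \<equiv> {(\<lambda>_. - 2 * int L * int N)..(\<lambda>_. 2 * int L * int N)}"

text \<open>Otherwise ever finer grids carry pseudo-orbits of length \<open>k\<close> from the cube
  to its outside. Their limit is a true orbit that ends outside the open cube, which contradicts
  strict absorption.\<close>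

lemma grid_absorbing:
  fixes f :: "real ^ 'n \<Rightarrow> real ^ 'n"
  assumes f: "continuous_on UNIV f" and abs: "\<And>x. x \<in> cube L \<Longrightarrow> (f ^^ k) x \<in> open_cube L"
  shows "\<exists>N0. \<forall>N>N0. (box_carrier.step (grid_lo f N) (grid_hi f N) ^^ k) (cube_cells L N) \<subseteq> cube_cells L N"
proof (rule ccontr)
  let ?step = "\<lambda>N. box_carrier.step (grid_lo f N) (grid_hi f N)"
  assume "\<not> ?thesis"
  then have "\<forall>i. \<exists>N>i. \<exists>Q\<in>(?step N ^^ k) (cube_cells L N). Q \<notin> cube_cells L N"
    by blast
  then obtain N Q where N: "\<And>i. N i > i"
    and Q: "\<And>i. Q i \<in> (?step (N i) ^^ k) (cube_cells L (N i))" "\<And>i. Q i \<notin> cube_cells L (N i)"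
    by metis
  have Npos: "N i > 0" for i
    using N[of i] by simp
  have "\<exists>c. c 0 \<in> cube L \<and> c k \<notin> cube L \<and> (\<forall>j<k. approx f (CARD('n) / N i) (c j) (c (Suc j)))" for i
  proof -
    obtain c where c: "c 0 \<in> midpt (N i) ` cube_cells L (N i)" "c k = midpt (N i) (Q i)"
      "\<And>j. j < k \<Longrightarrow> approx f (CARD('n) / N i) (c j) (c (Suc j))"
      by (rule grid_chain[OF f Npos[of i] Q(1)[of i]]) blast
    have "midpt (N i) P \<in> cube L" if "P \<in> cube_cells L (N i)" for P :: "'n cell"
      using iffD2[OF midpt_in_cube[OF Npos[of i]] that] .
    then have "c 0 \<in> cube L"
      using c(1) by (elim imageE) simp
    moreover have "c k \<notin> cube L"
      unfolding c(2) midpt_in_cube[OF Npos[of i]] by (rule Q(2))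
    ultimately show ?thesis
      using c(3) by blast
  qed
  then obtain c where c: "\<And>i. c i 0 \<in> cube L" "\<And>i. c i k \<notin> cube L"
    "\<And>i j. j < k \<Longrightarrow> approx f (CARD('n) / N i) (c i j) (c i (Suc j))"
    by metis
  have "\<exists>x\<in>cube L. (f ^^ k) x \<in> - open_cube L"
  proof (rule approx_chain_limit[OF f tendsto_mesh[OF N, of "CARD('n)"] compact_cbox])
    show "approx f (CARD('n) / N i) (c i j) (c i (Suc j))" if "j < k" for i j
      by (rule c(3)[OF that])
    show "c i k \<in> - open_cube L" for i
      using c(2)[of i] box_subset_cbox by blast
  qed (simp_all add: c(1) closed_def open_box)
  with abs show False by blast
qed

section \<open>Fixed points of bounded maps\<close>

lemma is_window_map_iff:
  "is_window (map_forward_orbit f) W \<longleftrightarrow> compact W \<and> (\<forall>x. \<exists>k. (f ^^ k) x \<in> W)"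
proof -
  have "map_forward_orbit f x \<inter> W \<noteq> {} \<longleftrightarrow> (\<exists>k. (f ^^ k) x \<in> W)" for x
    by (auto simp: map_forward_orbit_def)
  then show ?thesis
    by (simp add: is_window_def)
qed

lemma is_window_flow_iff:
  "is_window (flow_forward_orbit \<phi>) W \<longleftrightarrow> compact W \<and> (\<forall>x. \<exists>t\<ge>0. \<phi> t x \<in> W)"
proof -
  have "flow_forward_orbit \<phi> x \<inter> W \<noteq> {} \<longleftrightarrow> (\<exists>t\<ge>0. \<phi> t x \<in> W)" for x
    by (auto simp: flow_forward_orbit_def)
  then show ?thesis
    by (simp add: is_window_def)
qed

lemma bounded_map_fixed_point:
  fixes f :: "real ^ 'n \<Rightarrow> real ^ 'n"
  assumes f: "continuous_on UNIV f" and "bounded_map f"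
  shows "\<exists>p. f p = p"
proof -
  obtain W where "compact W" "\<And>x. \<exists>k. (f ^^ k) x \<in> W"
    using \<open>bounded_map f\<close> by (auto simp: bounded_map_def is_window_map_iff)
  then obtain L m' where abs: "\<And>k x. m' \<le> k \<Longrightarrow> x \<in> cube L \<Longrightarrow> (f ^^ k) x \<in> open_cube L"
    using absorbing_cube[OF f \<open>compact W\<close>] by metis
  \<comment> \<open>A positive \<open>m\<close> makes the subtraction in
    \<open>absorbed_of_interval\<close> a genuine descent.\<close>
  define m where "m = Suc m'"
  have "m > 0"
    by (simp add: m_def)
  let ?step = "\<lambda>N. box_carrier.step (grid_lo f N) (grid_hi f N)"
  have "\<exists>N0. \<forall>N>N0. (?step N ^^ k) (cube_cells L N) \<subseteq> cube_cells L N" if "m \<le> k" for k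
    using that by (intro grid_absorbing[OF f] abs) (auto simp: m_def)
  then obtain N0 where N0: "\<And>k N. m \<le> k \<Longrightarrow> N0 k < N \<Longrightarrow> (?step N ^^ k) (cube_cells L N) \<subseteq> cube_cells L N"
    by metis
  \<comment> \<open>The threshold \<open>N0 k\<close> depends on \<open>k\<close>; one period of
    exponents is enough, so a finite maximum serves all of them.\<close>
  define M where "M = Max (N0 ` {m..<2 * m})"
  have cells: "\<exists>Q\<in>cube_cells L N. Q \<in> {grid_lo f N Q..grid_hi f N Q}" if "N > M" for N
  proof -
    interpret box_carrier "grid_lo f N" "grid_hi f N"
      by (rule box_carrier_grid[OF f])
    have interval: "(step ^^ k) (cube_cells L N) \<subseteq> cube_cells L N" if "k \<in> {m..<2 * m}" for k
    proof (rule N0)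
      have "N0 k \<le> M"
        unfolding M_def using that by (intro Max_ge) auto
      then show "N0 k < N"
        using \<open>N > M\<close> by simp
    qed (use that in auto)
    show ?thesis
    proof (rule fixed_cell[where m = m])
      show "(step ^^ k) (cube_cells L N) \<subseteq> cube_cells L N" if "m \<le> k" for k
        using step_mono \<open>m > 0\<close> interval that by (rule absorbed_of_interval)
    qed (simp_all add: vertex_def le_fun_def)
  qed
  \<comment> \<open>The midpoint of a cell lying in its own carrier is an approximate fixed point; a
    limit of such points is fixed.\<close>
  have "\<exists>x. x \<in> cube L \<and> approx f (CARD('n) / (M + Suc i)) x x" for i
  proof -
    obtain Q where Q: "Q \<in> cube_cells L (M + Suc i)"
      "Q \<in> {grid_lo f (M + Suc i) Q..grid_hi f (M + Suc i) Q}"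
      using cells[of "M + Suc i"] by auto
    have "0 < M + Suc i"
      by simp
    then show ?thesis
      using iffD2[OF midpt_in_cube[of "M + Suc i"] Q(1)] grid_carrier_approx[OF f _ Q(2)]
      by (intro exI[of _ "midpt (M + Suc i) Q"] conjI) blast+
  qed
  then obtain p where p: "\<And>i. p i \<in> cube L" "\<And>i. approx f (CARD('n) / (M + Suc i)) (p i) (p i)"
    by metis
  obtain x \<sigma> where \<sigma>: "strict_mono \<sigma>" and lim: "(p \<circ> \<sigma>) \<longlonglongrightarrow> x"
    using p(1) compact_cbox unfolding compact_def by meson
  have "(\<lambda>i. CARD('n) / real (M + Suc (\<sigma> i))) \<longlonglongrightarrow> 0"
    using seq_suble[OF \<sigma>] by (intro tendsto_mesh) (auto simp: less_Suc_eq_le intro: trans_le_add2)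
  then have "(p \<circ> \<sigma>) \<longlonglongrightarrow> f x"
    by (rule approx_tendsto[OF f _ lim]) (simp only: comp_apply p(2))
  with lim have "f x = x"
    using LIMSEQ_unique by blast
  then show ?thesis ..
qed

section \<open>Fixed points of bounded flows\<close>

lemma continuous_flow_continuous_on:
  assumes "continuous_flow \<phi>"
  shows "continuous_on UNIV (\<phi> t)" "continuous_on UNIV (\<lambda>t. \<phi> t x)"
proof -
  have \<phi>: "continuous_on UNIV (\<lambda>(t, x). \<phi> t x)"
    using assms by (simp add: continuous_flow_def)
  show "continuous_on UNIV (\<phi> t)"
    using continuous_on_compose2[OF \<phi>, of UNIV "\<lambda>x. (t, x)"] by (simp add: continuous_on_Pair)
  show "continuous_on UNIV (\<lambda>t. \<phi> t x)"
    using continuous_on_compose2[OF \<phi>, of UNIV "\<lambda>t. (t, x)"] by (simp add: continuous_on_Pair)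
qed

lemma flow_funpow:
  assumes "continuous_flow \<phi>"
  shows "(\<phi> s ^^ k) x = \<phi> (real k * s) x"
proof (induction k)
  case (Suc k)
  have "\<phi> (s + real k * s) x = \<phi> s (\<phi> (real k * s) x)"
    using assms by (simp add: continuous_flow_def)
  with Suc show ?case by (simp add: distrib_right)
qed (use assms in \<open>simp add: continuous_flow_def\<close>)

lemma bounded_flow_fixed_point:
  fixes \<phi> :: "real \<Rightarrow> real ^ 'n \<Rightarrow> real ^ 'n"
  assumes flow: "continuous_flow \<phi>" and "bounded_flow \<phi>"
  shows "\<exists>p. \<forall>t. \<phi> t p = p"
proof -
  obtain W where "compact W" and W: "\<And>x. \<exists>t\<ge>0. \<phi> t x \<in> W"
    using \<open>bounded_flow \<phi>\<close> by (auto simp: bounded_flow_def is_window_flow_iff)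
  have add: "\<phi> (s + t) x = \<phi> s (\<phi> t x)" and zero: "\<phi> 0 x = x" for s t x
    using flow by (simp_all add: continuous_flow_def)
  \<comment> \<open>Sampling at multiples of \<open>s j\<close> may miss \<open>W\<close>, but the
    next sample comes within time 1; hence \<open>V\<close> is a window for all these maps at
    once.\<close>
  define V where "V = (\<lambda>(t, x). \<phi> t x) ` ({0..1} \<times> W)"
  have V: "compact V"
    unfolding V_def using flow \<open>compact W\<close>
    by (intro compact_continuous_image compact_Times compact_Icc)
      (auto simp: continuous_flow_def intro: continuous_on_subset)
  define s :: "nat \<Rightarrow> real" where "s j = 1 / 2 ^ j" for j
  have s: "0 < s j" "s j \<le> 1" for j
    by (simp_all add: s_def)
  have window: "\<exists>k. (\<phi> (s j) ^^ k) x \<in> V" for j x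
  proof -
    obtain t where t: "0 \<le> t" "\<phi> t x \<in> W"
      using W by blast
    define k where "k = nat \<lceil>t / s j\<rceil>"
    have "real k = of_int \<lceil>t / s j\<rceil>"
      using t s[of j] by (simp add: k_def)
    then have "t / s j \<le> real k" "real k \<le> t / s j + 1"
      by linarith+
    then have "t \<le> real k * s j" "real k * s j \<le> t + s j"
      using s[of j] by (simp_all add: field_simps)
    then have "real k * s j - t \<in> {0..1}"
      using s[of j] by auto
    then have "\<phi> (real k * s j - t) (\<phi> t x) \<in> V"
      unfolding V_def using t by (intro image_eqI[of _ _ "(real k * s j - t, \<phi> t x)"]) simp_all
    then have "(\<phi> (s j) ^^ k) x \<in> V"
      by (simp add: flow_funpow[OF flow] flip: add)
    then show ?thesis ..
  qed
  define F where "F j = {p \<in> V. \<phi> (s j) p = p}" for j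
  have "F j \<noteq> {}" for j
  proof -
    have "bounded_map (\<phi> (s j))"
      unfolding bounded_map_def is_window_map_iff using V window[of j] by (intro exI[of _ V]) simp
    then obtain p where p: "\<phi> (s j) p = p"
      using bounded_map_fixed_point continuous_flow_continuous_on(1)[OF flow] by blast
    then have "(\<phi> (s j) ^^ k) p = p" for k
      by (induction k) auto
    \<comment> \<open>The orbit of a fixed point is constant, so the point itself lies in the
      window.\<close>
    then have "p \<in> V"
      using window[of j p] by simp
    with p show ?thesis
      by (auto simp: F_def)
  qed
  moreover have "compact (F j)" for j
  proof -
    have "closed {p. \<phi> (s j) p = p}"
      using continuous_flow_continuous_on(1)[OF flow] by (intro closed_Collect_eq) auto
    then have "compact (V \<inter> {p. \<phi> (s j) p = p})"
      by (rule compact_Int_closed[OF V])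
    then show ?thesis
      by (simp add: F_def Int_def)
  qed
  \<comment> \<open>Halving the time step makes the sets decrease, because \<open>s i\<close> is an
    integer multiple of \<open>s j\<close>.\<close>
  moreover have "F j \<subseteq> F i" if "i \<le> j" for i j
  proof
    fix p assume p: "p \<in> F j"
    then have "(\<phi> (s j) ^^ k) p = p" for k
      by (induction k) (auto simp: F_def)
    then have "\<phi> (real (2 ^ (j - i)) * s j) p = p"
      by (metis flow_funpow[OF flow])
    moreover have "(2::real) ^ j = 2 ^ i * 2 ^ (j - i)"
      using that by (simp flip: power_add)
    then have "real (2 ^ (j - i)) * s j = s i"
      by (simp add: s_def)
    ultimately show "p \<in> F i"
      using p by (simp add: F_def)
  qed
  ultimately have "\<Inter>(range F) \<noteq> {}"
    by (intro compact_nest)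
  then obtain p where "\<And>j. \<phi> (s j) p = p"
    by (auto simp: F_def)
  then have "(\<phi> (s j) ^^ k) p = p" for j k
    by (induction k) auto
  then have dyadic: "\<phi> (real k * s j) p = p" for j k
    by (simp add: flow_funpow[OF flow])
  have pos: "\<phi> t p = p" if "0 \<le> t" for t
  proof -
    \<comment> \<open>Multiples of \<open>s j\<close> just below \<open>t\<close>: they fix
      \<open>p\<close>, they tend to \<open>t\<close>, and continuity in time passes to the
      limit.\<close>
    define u where "u j = real (nat \<lfloor>t / s j\<rfloor>) * s j" for j
    have "dist (u j) t \<le> s j" for j
    proof -
      have "real (nat \<lfloor>t / s j\<rfloor>) = of_int \<lfloor>t / s j\<rfloor>"
        using that s[of j] by simp
      then have "real (nat \<lfloor>t / s j\<rfloor>) \<le> t / s j" "t / s j \<le> real (nat \<lfloor>t / s j\<rfloor>) + 1"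
        by linarith+
      then have "u j \<le> t" "t \<le> u j + s j"
        using s[of j] by (simp_all add: u_def field_simps)
      then show ?thesis
        unfolding dist_real_def by linarith
    qed
    moreover have "s \<longlonglongrightarrow> 0"
      unfolding s_def using LIMSEQ_realpow_zero[of "1 / 2 :: real"] by (simp add: power_one_over)
    ultimately have "(\<lambda>j. dist (u j) t) \<longlonglongrightarrow> 0"
      using Lim_null_comparison[of "\<lambda>j. dist (u j) t" s sequentially] by simp
    then have "u \<longlonglongrightarrow> t"
      by (rule iffD2[OF tendsto_dist_iff])
    then have "(\<lambda>j. \<phi> (u j) p) \<longlonglongrightarrow> \<phi> t p"
      by (rule continuous_on_tendsto_compose[OF continuous_flow_continuous_on(2)[OF flow]]) simp_all
    then have "(\<lambda>j. p) \<longlonglongrightarrow> \<phi> t p"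
      by (simp add: u_def dyadic)
    then show ?thesis
      by (rule LIMSEQ_unique[OF tendsto_const, symmetric])
  qed
  have "\<phi> t p = p" for t
  proof (cases "0 \<le> t")
    case False
    \<comment> \<open>The positive time \<open>- t\<close> fixes \<open>p\<close>, and the group law
      undoes it.\<close>
    then have "\<phi> t p = \<phi> t (\<phi> (- t) p)"
      by (simp add: pos)
    also have "\<dots> = p"
      by (simp add: zero flip: add)
    finally show ?thesis .
  qed (rule pos)
  then show ?thesis by blast
qed

theorem theorem1:
  shows "(\<forall>f :: real ^ 'n \<Rightarrow> real ^ 'n.
            continuous_on UNIV f \<and> bounded_map f \<longrightarrow> (\<exists>p. f p = p)) \<and>
         (\<forall>\<phi> :: real \<Rightarrow> real ^ 'n \<Rightarrow> real ^ 'n.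
            continuous_flow \<phi> \<and> bounded_flow \<phi> \<longrightarrow> (\<exists>p. \<forall>t. \<phi> t p = p))"
  using bounded_map_fixed_point bounded_flow_fixed_point by blast

end
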